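(* Let $R$ be a commutative Noetherian ring, let $n\ge 0$ be an integer, and let $M$ be a finitely generated $R$-module such that for all prime ideals $\mathfrak p,\mathfrak q\in\mathfrak C_n$, $\operatorname{depth}(R_{\mathfrak p})>\operatorname{depth}(R_{\mathfrak q})$ implies $\mu(M_{\mathfrak p})\ge \mu(M_{\mathfrak q})$. Then: (1) If $\mu(M_{\mathfrak p})>n$ for every $\mathfrak p\in\mathfrak C_n$, then there exists $x\in M$ which is basic in $M$ at every $\mathfrak p\in\mathfrak C_n$. (2) Let $k\ge 1$, let $x_1,\dots,x_k\in M$ and put $M'=\sum_{i=1}^k Rx_i$. If, for every $\mathfrak p\in\mathfrak C_n$, $M'$ is $\min(k,\,n+1-\operatorname{depth}(R_{\mathfrak p}))$-basic in $M$ at $\mathfrak p$, then there exists $x'\in\sum_{i=2}^k Rx_i$ such that $x_1+x'$ is basic in $M$ at every $\mathfrak p\in\mathfrak C_n$.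
   Context: All modules are finitely generated. For a finitely generated module $N$ over a local ring, $\mu(N)$ denotes the minimal number of generators of $N$. For an integer $n\ge 0$, $\mathfrak C_n$ denotes the set of prime ideals $\mathfrak p$ of $R$ with $\operatorname{depth}(R_{\mathfrak p})\le n$. For a submodule $M'\subseteq M$, an integer $s$ and a prime $\mathfrak p$, $M'$ is called $s$-basic in $M$ at $\mathfrak p$ if $\mu((M/M')_{\mathfrak p})\le \mu(M_{\mathfrak p})-s$. An element $x\in M$ is called basic in $M$ at $\mathfrak p$ if $Rx$ is $1$-basic in $M$ at $\mathfrak p$. *)

theory Defs
  imports Main "HOL.Modules"
begin

text \<open>Commutative rings are types of class comm_ring_1; an R-module is a type 'm of class
  ab_group_add together with a scalar multiplication scale satisfying the module locale.
  Ideals are submodules of the ring viewed as a module over itself.\<close>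

definition ideal_gen :: "'a::comm_ring_1 set \<Rightarrow> 'a set" where
  "ideal_gen S = module.span ((*) :: 'a \<Rightarrow> 'a \<Rightarrow> 'a) S"

definition is_ideal :: "'a::comm_ring_1 set \<Rightarrow> bool" where
  "is_ideal I = module.subspace ((*) :: 'a \<Rightarrow> 'a \<Rightarrow> 'a) I"

definition prime_ideal :: "'a::comm_ring_1 set \<Rightarrow> bool" where
  "prime_ideal P \<longleftrightarrow> is_ideal P \<and> P \<noteq> UNIV \<and> (\<forall>a b. a * b \<in> P \<longrightarrow> a \<in> P \<or> b \<in> P)"

definition noetherian_ring :: "'a::comm_ring_1 itself \<Rightarrow> bool" where
  "noetherian_ring _ \<longleftrightarrow> (\<forall>I::'a set. is_ideal I \<longrightarrow> (\<exists>S. finite S \<and> I = ideal_gen S))"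

definition finitely_generated_module :: "('a::comm_ring_1 \<Rightarrow> 'm::ab_group_add \<Rightarrow> 'm) \<Rightarrow> bool" where
  "finitely_generated_module scale \<longleftrightarrow> (\<exists>S. finite S \<and> module.span scale S = UNIV)"

text \<open>Localization at a prime P, written out: for an ideal I of R, r/1 lies in the
  extended ideal I R_P iff u r \<in> I for some u \<notin> P.\<close>
definition in_loc_ideal :: "'a::comm_ring_1 set \<Rightarrow> 'a set \<Rightarrow> 'a \<Rightarrow> bool" where
  "in_loc_ideal P I r \<longleftrightarrow> (\<exists>u. u \<notin> P \<and> u * r \<in> I)"

text \<open>a_1/1, ..., a_d/1 (with a_i \<in> P) is an R_P-regular sequence in the maximal ideal P R_P:
  each a_i/1 is a nonzerodivisor on R_P/(a_1,...,a_{i-1})R_P (the quotient by the whole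
  sequence is nonzero automatically since all a_i \<in> P). Every element of P R_P is a unit
  multiple of some a/1 with a \<in> P, so this loses no generality.\<close>
definition loc_regular_seq :: "'a::comm_ring_1 set \<Rightarrow> 'a list \<Rightarrow> bool" where
  "loc_regular_seq P as \<longleftrightarrow> set as \<subseteq> P \<and>
     (\<forall>i < length as. \<forall>r. in_loc_ideal P (ideal_gen (set (take i as))) (as ! i * r)
                             \<longrightarrow> in_loc_ideal P (ideal_gen (set (take i as))) r)"

text \<open>depth(R_P): the supremum of lengths of R_P-regular sequences in P R_P
  (finite since R is Noetherian).\<close>
definition depth_loc :: "'a::comm_ring_1 set \<Rightarrow> nat" where
  "depth_loc P = Sup {length as | as. loc_regular_seq P as}"

text \<open>mu_loc scale P N = \<mu>((M/N)_P), M the module (the whole type 'm), N \<subseteq> M a submodule: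
  the minimal number of generators of (M/N)_P over R_P. Generators can be taken of the form
  image of m/1; a finite S \<subseteq> M generates (M/N)_P iff every m/1 lies in the R_P-span of
  (S \<union> N)/1, i.e. s m \<in> span (S \<union> N) for some s \<notin> P.\<close>
definition mu_loc :: "('a::comm_ring_1 \<Rightarrow> 'm::ab_group_add \<Rightarrow> 'm) \<Rightarrow> 'a set \<Rightarrow> 'm set \<Rightarrow> nat" where
  "mu_loc scale P N = (LEAST c. \<exists>S. finite S \<and> card S = c \<and>
       (\<forall>m. \<exists>s. s \<notin> P \<and> scale s m \<in> module.span scale (S \<union> N)))"

definition s_basic :: "('a::comm_ring_1 \<Rightarrow> 'm::ab_group_add \<Rightarrow> 'm) \<Rightarrow> int \<Rightarrow> 'a set \<Rightarrow> 'm set \<Rightarrow> bool" where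
  "s_basic scale s P M' \<longleftrightarrow> int (mu_loc scale P M') \<le> int (mu_loc scale P {}) - s"

definition basic :: "('a::comm_ring_1 \<Rightarrow> 'm::ab_group_add \<Rightarrow> 'm) \<Rightarrow> 'a set \<Rightarrow> 'm \<Rightarrow> bool" where
  "basic scale P x \<longleftrightarrow> s_basic scale 1 P (module.span scale {x})"

definition C_set :: "nat \<Rightarrow> 'a::comm_ring_1 set set" where
  "C_set n = {P. prime_ideal P \<and> depth_loc P \<le> n}"

end

theory Submission
  imports Defs
begin

text \<open>Part (1) is part (2) for a generating family of \<open>M\<close>, and part (2) is proved by lowering the
  number of generators one at a time (Eisenbud--Evans): replace \<open>x\<^sub>1, \<dots>, x\<^sub>k\<close> by
  \<open>x\<^sub>i + a\<^sub>i x\<^sub>k\<close> for \<open>i < k\<close>. This can spoil the hypothesis only at the primes \<open>P\<close> of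
  \<open>\<CC>\<^sub>n\<close> with \<open>n + 1 - depth R\<^sub>P < k\<close> at which the hypothesis is an equality. The condition on
  \<open>\<mu>(M\<^sub>P)\<close> forces such a prime to have minimal depth on the closed set where \<open>M/M'\<close> needs at
  least \<open>\<mu>((M/M')\<^sub>P)\<close> generators, so it is associated to the ideal of a maximal regular sequence
  inside the ideal of that closed set, and there are only finitely many of them. At these primes
  \<open>x\<^sub>1, \<dots>, x\<^sub>k\<close> are linearly dependent in the fibre, and coefficients \<open>a\<^sub>i\<close> chosen by prime
  avoidance keep the span of the generators in all these fibres.\<close>

section \<open>Ideals of Noetherian rings\<close>

interpretation ring_module: module "(*) :: 'a::comm_ring_1 \<Rightarrow> 'a \<Rightarrow> 'a"
  by standard (simp_all add: algebra_simps)

declare ring_module.scale_scale [simp del] \<comment> \<open>loops with \<open>mult.assoc\<close>\<close>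

lemma is_ideal_ideal_gen: "is_ideal (ideal_gen B)"
  by (simp add: is_ideal_def ideal_gen_def)

lemma ideal_zero: "is_ideal I \<Longrightarrow> 0 \<in> I"
  by (simp add: is_ideal_def ring_module.subspace_0)

lemma ideal_add: "is_ideal I \<Longrightarrow> a \<in> I \<Longrightarrow> b \<in> I \<Longrightarrow> a + b \<in> I"
  by (simp add: is_ideal_def ring_module.subspace_add)

lemma ideal_diff: "is_ideal I \<Longrightarrow> a \<in> I \<Longrightarrow> b \<in> I \<Longrightarrow> a - b \<in> I"
  by (simp add: is_ideal_def ring_module.subspace_diff)

lemma ideal_mult: "is_ideal I \<Longrightarrow> a \<in> I \<Longrightarrow> r * a \<in> I"
  by (simp add: is_ideal_def ring_module.subspace_scale)

lemma ideal_mult2: "is_ideal I \<Longrightarrow> a \<in> I \<Longrightarrow> a * r \<in> I"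
  using ideal_mult[of I a r] by (simp add: mult.commute)

lemma is_idealI:
  "0 \<in> I \<Longrightarrow> (\<And>a b. a \<in> I \<Longrightarrow> b \<in> I \<Longrightarrow> a + b \<in> I) \<Longrightarrow> (\<And>r a. a \<in> I \<Longrightarrow> r * a \<in> I) \<Longrightarrow> is_ideal I"
  unfolding is_ideal_def by (rule ring_module.subspaceI)

lemma ideal_gen_least: "is_ideal I \<Longrightarrow> B \<subseteq> I \<Longrightarrow> ideal_gen B \<subseteq> I"
  unfolding is_ideal_def ideal_gen_def by (rule ring_module.span_minimal)

lemma ideal_gen_superset: "B \<subseteq> ideal_gen B"
  unfolding ideal_gen_def by (rule ring_module.span_superset)

lemma ideal_gen_mono: "A \<subseteq> B \<Longrightarrow> ideal_gen A \<subseteq> ideal_gen B"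
  unfolding ideal_gen_def by (rule ring_module.span_mono)

lemma ideal_gen_insert: "r \<in> ideal_gen (insert a B) \<longleftrightarrow> (\<exists>c. r - c * a \<in> ideal_gen B)"
  unfolding ideal_gen_def ring_module.span_insert by simp

lemma ideal_gen_ideal: "is_ideal I \<Longrightarrow> ideal_gen I = I"
  using ideal_gen_least[of I I] ideal_gen_superset[of I] by blast

lemma prime_ideal_ideal: "prime_ideal P \<Longrightarrow> is_ideal P"
  by (simp add: prime_ideal_def)

lemma prime_ideal_one: "prime_ideal P \<Longrightarrow> 1 \<notin> P"
  using ideal_mult2[of P 1] by (auto simp: prime_ideal_def)

lemma prime_ideal_mult_notin: "prime_ideal P \<Longrightarrow> a \<notin> P \<Longrightarrow> b \<notin> P \<Longrightarrow> a * b \<notin> P"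
  by (auto simp: prime_ideal_def)

lemma prime_ideal_prod_notin:
  assumes "prime_ideal P" "\<And>x. x \<in> S \<Longrightarrow> f x \<notin> P"
  shows "(\<Prod>x\<in>S. f x) \<notin> P"
  using assms(2)
  by (induction S rule: infinite_finite_induct)
    (auto simp: prime_ideal_one[OF assms(1)] prime_ideal_mult_notin[OF assms(1)])

text \<open>The union of a strictly ascending chain would be an ideal whose finitely many generators
  already lie in one member, so the chain would stop there.\<close>

lemma noetherian_max_ideal:
  fixes \<F> :: "'a::comm_ring_1 set set"
  assumes noeth: "noetherian_ring TYPE('a)"
    and ideals: "\<And>I. I \<in> \<F> \<Longrightarrow> is_ideal I" and ne: "\<F> \<noteq> {}"
  shows "\<exists>M\<in>\<F>. \<forall>I\<in>\<F>. M \<subseteq> I \<longrightarrow> I = M"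
proof -
  have "wf {(I, J). J \<subset> I \<and> I \<in> \<F> \<and> J \<in> \<F>}"
    unfolding wf_iff_no_infinite_down_chain
  proof
    assume "\<exists>f. \<forall>i. (f (Suc i), f i) \<in> {(I, J). J \<subset> I \<and> I \<in> \<F> \<and> J \<in> \<F>}"
    then obtain f where f: "\<forall>i. (f (Suc i), f i) \<in> {(I, J). J \<subset> I \<and> I \<in> \<F> \<and> J \<in> \<F>}" ..
    then have step: "f i \<subset> f (Suc i)" and f\<F>: "f i \<in> \<F>" for i
      by simp_all
    have mono: "f i \<subseteq> f j" if "i \<le> j" for i j
      using lift_Suc_mono_le[of f] step that by blast
    have "is_ideal (\<Union>i. f i)"
    proof (rule is_idealI)
      show "0 \<in> (\<Union>i. f i)"
        using ideal_zero[OF ideals[OF f\<F>]] by blast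
      show "a + b \<in> (\<Union>i. f i)" if ab: "a \<in> (\<Union>i. f i)" "b \<in> (\<Union>i. f i)" for a b
      proof -
        obtain i j where "a \<in> f i" "b \<in> f j"
          using ab by blast
        then have "a \<in> f (max i j)" "b \<in> f (max i j)"
          using mono by (metis max.cobounded1 subsetD, metis max.cobounded2 subsetD)
        then show ?thesis
          using ideal_add[OF ideals[OF f\<F>]] by blast
      qed
      show "r * a \<in> (\<Union>i. f i)" if "a \<in> (\<Union>i. f i)" for r a
        using that ideal_mult[OF ideals[OF f\<F>]] by blast
    qed
    then obtain S where S: "finite S" "(\<Union>i. f i) = ideal_gen S"
      using noeth unfolding noetherian_ring_def by meson
    have "S \<subseteq> (\<Union>i. f i)"
      using ideal_gen_superset[of S] S(2) by simp
    with S(1) have "\<exists>k. S \<subseteq> f k"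
    proof (induction S)
      case (insert x S)
      obtain k where "S \<subseteq> f k"
        using insert.IH insert.prems by auto
      moreover obtain l where "x \<in> f l"
        using insert.prems by auto
      ultimately have "insert x S \<subseteq> f (max k l)"
        using mono[of k "max k l"] mono[of l "max k l"] by auto
      then show ?case ..
    qed simp
    then obtain k where "S \<subseteq> f k"
      by blast
    then have "(\<Union>i. f i) \<subseteq> f k"
      unfolding S(2) by (rule ideal_gen_least[OF ideals[OF f\<F>]])
    then show False
      using step[of k] by blast
  qed
  moreover obtain I where "I \<in> \<F>"
    using ne by blast
  ultimately obtain M where "M \<in> \<F>" "\<And>I. (I, M) \<in> {(I, J). J \<subset> I \<and> I \<in> \<F> \<and> J \<in> \<F>} \<Longrightarrow> I \<notin> \<F>"
    by (rule wfE_min) blast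
  then have "\<forall>I\<in>\<F>. M \<subseteq> I \<longrightarrow> I = M"
    by blast
  with \<open>M \<in> \<F>\<close> show ?thesis ..
qed

section \<open>Prime avoidance\<close>

text \<open>Multiply one element of each \<open>Q - P\<close>; primality of \<open>P\<close> keeps
  the product outside \<open>P\<close>.\<close>

lemma exists_outside_prime:
  assumes "finite \<Q>" "prime_ideal P" "\<And>Q. Q \<in> \<Q> \<Longrightarrow> is_ideal Q \<and> \<not> Q \<subseteq> P"
  obtains a where "a \<notin> P" "\<And>Q. Q \<in> \<Q> \<Longrightarrow> a \<in> Q"
proof -
  have "\<exists>a. a \<notin> P \<and> (\<forall>Q\<in>\<Q>. a \<in> Q)"
    using assms(1,3)
  proof (induction \<Q>)
    case empty
    then show ?case
      using prime_ideal_one[OF assms(2)] by blast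
  next
    case (insert Q \<Q>)
    then obtain a where a: "a \<notin> P" "\<forall>Q\<in>\<Q>. a \<in> Q"
      by blast
    obtain b where b: "b \<in> Q" "b \<notin> P"
      using insert.prems by blast
    have "a * b \<notin> P"
      using a(1) b(2) by (rule prime_ideal_mult_notin[OF assms(2)])
    moreover have "a * b \<in> Q'" if "Q' \<in> insert Q \<Q>" for Q'
      using that insert.prems a(2) b(1) ideal_mult[of Q' b a] ideal_mult2[of Q' a b] by blast
    ultimately show ?case
      by blast
  qed
  then show thesis
    using that by blast
qed

text \<open>Fixes the order in which finitely many primes are treated: a minimal one comes last. No
  other prime lies below it, so \<open>exists_outside_prime\<close> supplies a coefficient outside
  it and inside all the others.\<close>

lemma finite_remove_minimal_induct [consumes 1, case_names empty remove]:
  fixes A :: "'b::order set"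
  assumes "finite A" "P {}"
    and step: "\<And>A x. finite A \<Longrightarrow> x \<in> A \<Longrightarrow> (\<And>y. y \<in> A - {x} \<Longrightarrow> \<not> y \<le> x) \<Longrightarrow> P (A - {x}) \<Longrightarrow> P A"
  shows "P A"
  using assms(1)
proof (induction A rule: finite_psubset_induct)
  case (psubset A)
  show ?case
  proof (cases "A = {}")
    case False
    then obtain x where "x \<in> A" "\<forall>y\<in>A. y \<le> x \<longrightarrow> x = y"
      using finite_has_minimal psubset.hyps by metis
    then show ?thesis
      using psubset.IH[of "A - {x}"] by (intro step[OF psubset.hyps, of x]) auto
  qed (simp add: assms(2))
qed

text \<open>An element \<open>z\<close> found for the other primes can fail only at the last prime
  \<open>Q\<close>. Adding \<open>a * y\<close>, with \<open>y\<close> in \<open>I - Q\<close> and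
  \<open>a\<close> outside \<open>Q\<close> but in all other primes, repairs this and leaves
  \<open>z\<close> unchanged modulo the others.\<close>

lemma prime_avoidance:
  assumes "finite \<Q>" "is_ideal I" "\<And>Q. Q \<in> \<Q> \<Longrightarrow> prime_ideal Q \<and> \<not> I \<subseteq> Q"
  shows "\<exists>z\<in>I. \<forall>Q\<in>\<Q>. z \<notin> Q"
  using assms(1,3)
proof (induction \<Q> rule: finite_remove_minimal_induct)
  case empty
  then show ?case
    using ideal_zero[OF assms(2)] by blast
next
  case (remove \<Q> Q)
  then obtain z where z: "z \<in> I" "\<forall>Q'\<in>\<Q> - {Q}. z \<notin> Q'"
    by blast
  show ?case
  proof (cases "z \<in> Q")
    case True
    have Q: "prime_ideal Q"
      using remove by blast
    obtain a where a: "a \<notin> Q" "\<And>Q'. Q' \<in> \<Q> - {Q} \<Longrightarrow> a \<in> Q'"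
      using exists_outside_prime[of "\<Q> - {Q}" Q] remove Q
      by (metis finite_Diff prime_ideal_ideal DiffD1)
    obtain y where y: "y \<in> I" "y \<notin> Q"
      using remove by blast
    have "a * y \<notin> Q"
      using a(1) y(2) by (rule prime_ideal_mult_notin[OF Q])
    then have "z + a * y \<notin> Q"
      using True ideal_diff[OF prime_ideal_ideal[OF Q], of "z + a * y" z] by auto
    moreover have "z + a * y \<notin> Q'" if "Q' \<in> \<Q> - {Q}" for Q'
    proof
      assume *: "z + a * y \<in> Q'"
      have "is_ideal Q'"
        using that remove.prems prime_ideal_ideal by blast
      then have "z + a * y - a * y \<in> Q'"
        using * a(2)[OF that] by (intro ideal_diff) (auto intro: ideal_mult2)
      then show False
        using z(2) that by simp
    qed
    moreover have "z + a * y \<in> I"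
      using z(1) y(1) assms(2) by (auto intro: ideal_add ideal_mult)
    ultimately show ?thesis
      by blast
  qed (use z in blast)
qed

section \<open>Associated primes of R/J\<close>

definition assoc_primes :: "'a::comm_ring_1 set \<Rightarrow> 'a set set" where
  "assoc_primes J = {Q. prime_ideal Q \<and> (\<exists>u. Q = {r. r * u \<in> J})}"

lemma is_ideal_colon:
  assumes "is_ideal J"
  shows "is_ideal {r. r * u \<in> J}"
proof (rule is_idealI)
  show "r * a \<in> {r. r * u \<in> J}" if "a \<in> {r. r * u \<in> J}" for r a
    using ideal_mult[OF assms, of "a * u" r] that by (simp add: mult.assoc)
  show "a + b \<in> {r. r * u \<in> J}" if "a \<in> {r. r * u \<in> J}" "b \<in> {r. r * u \<in> J}" for a b
    using ideal_add[OF assms, of "a * u" "b * u"] that by (simp add: distrib_right)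
qed (simp add: ideal_zero[OF assms])

text \<open>A maximal one among the annihilators of nonzero classes of \<open>R/J\<close> is prime.
  Consequently the zero divisors modulo \<open>J\<close> are covered by the associated
  primes.\<close>

lemma colon_subset_assoc_prime:
  fixes J :: "'a::comm_ring_1 set"
  assumes noeth: "noetherian_ring TYPE('a)" and J: "is_ideal J" and v: "v \<notin> J"
  shows "\<exists>Q\<in>assoc_primes J. {r. r * v \<in> J} \<subseteq> Q"
proof -
  let ?F = "{{r. r * u \<in> J} | u. u \<notin> J \<and> {r. r * v \<in> J} \<subseteq> {r. r * u \<in> J}}"
  have ideals: "\<And>I. I \<in> ?F \<Longrightarrow> is_ideal I"
    using is_ideal_colon[OF J] by auto
  have ne: "?F \<noteq> {}"
    using v by blast
  obtain Q where Q: "Q \<in> ?F" "\<forall>I\<in>?F. Q \<subseteq> I \<longrightarrow> I = Q"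
    using noetherian_max_ideal[OF noeth ideals ne] by (rule bexE)
  then obtain u where u: "Q = {r. r * u \<in> J}" "u \<notin> J" "{r. r * v \<in> J} \<subseteq> Q"
    by blast
  have "a \<in> Q \<or> b \<in> Q" if ab: "a * b \<in> Q" for a b
  proof (rule disjCI)
    assume b: "b \<notin> Q"
    have sub: "Q \<subseteq> {r. r * (b * u) \<in> J}"
    proof
      fix x
      assume "x \<in> Q"
      then have "b * (x * u) \<in> J"
        using ideal_mult[OF J] by (simp add: u(1))
      then show "x \<in> {r. r * (b * u) \<in> J}"
        by (simp add: mult.left_commute)
    qed
    then have "{r. r * (b * u) \<in> J} = Q"
      using b u by (intro Q(2)[rule_format]) (auto simp: subset_iff)
    then show "a \<in> Q"
      using ab by (auto simp: u(1) mult.assoc)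
  qed
  moreover have "Q \<noteq> UNIV"
    using u(1,2) by (metis UNIV_I mem_Collect_eq mult_1)
  ultimately have "prime_ideal Q"
    using ideals[OF Q(1)] by (auto simp: prime_ideal_def)
  then show ?thesis
    using u by (auto simp: assoc_primes_def)
qed

text \<open>Noetherian induction: take \<open>J\<close> maximal among the counterexamples and
  \<open>u\<close> with prime annihilator \<open>P\<close> modulo \<open>J\<close>. Every associated
  prime of \<open>J\<close> is then \<open>P\<close> or is associated to the larger ideal
  \<open>J + (u)\<close>, which has only finitely many.\<close>

lemma finite_assoc_primes:
  fixes J :: "'a::comm_ring_1 set"
  assumes noeth: "noetherian_ring TYPE('a)" and "is_ideal J"
  shows "finite (assoc_primes J)"
proof (rule ccontr)
  let ?F = "{J :: 'a set. is_ideal J \<and> infinite (assoc_primes J)}"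
  assume "infinite (assoc_primes J)"
  then have "?F \<noteq> {}"
    using assms(2) by blast
  then have "\<exists>M\<in>?F. \<forall>I\<in>?F. M \<subseteq> I \<longrightarrow> I = M"
    by (intro noetherian_max_ideal[OF noeth]) simp
  then obtain J where J: "is_ideal J" "infinite (assoc_primes J)"
    and max: "\<forall>I\<in>?F. J \<subseteq> I \<longrightarrow> I = J"
    by blast
  have "1 \<notin> J"
  proof
    assume "1 \<in> J"
    then have "r \<in> J" for r
      using ideal_mult[OF J(1), of 1 r] by simp
    then have "assoc_primes J = {}"
      by (auto simp: assoc_primes_def prime_ideal_def)
    then show False
      using J(2) by simp
  qed
  then obtain P where "P \<in> assoc_primes J"
    using colon_subset_assoc_prime[OF noeth J(1)] by blast
  then obtain u where P: "prime_ideal P" "P = {r. r * u \<in> J}"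
    by (auto simp: assoc_primes_def)
  let ?J = "ideal_gen (insert u J)"
  have u: "u \<notin> J"
    using prime_ideal_one[OF P(1)] by (simp add: P(2))
  have "u \<in> ?J" "J \<subseteq> ?J"
    using ideal_gen_superset[of "insert u J"] by auto
  then have fin: "finite (assoc_primes ?J)"
    using max[rule_format, of ?J] u by (auto simp: is_ideal_ideal_gen)
  have "Q = P \<or> Q \<in> assoc_primes ?J" if "Q \<in> assoc_primes J" for Q
  proof -
    obtain v where Q: "prime_ideal Q" "Q = {r. r * v \<in> J}"
      using \<open>Q \<in> assoc_primes J\<close> by (auto simp: assoc_primes_def)
    show ?thesis
    proof (cases "Q = {r. r * v \<in> ?J}")
      case False
      then obtain r where r: "r \<notin> Q" "r * v \<in> ?J"
        using \<open>J \<subseteq> ?J\<close> by (auto simp: Q(2))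
      \<comment> \<open>The annihilator of \<open>v\<close> grows modulo \<open>J + (u)\<close>, so
        \<open>r * v\<close> agrees with \<open>s * u\<close> modulo \<open>J\<close>. Since
        \<open>r\<close> is outside \<open>Q\<close> and \<open>s\<close> outside \<open>P\<close>,
        this common class has annihilator \<open>Q\<close> and also \<open>P\<close>.\<close>
      then obtain s where s: "r * v - s * u \<in> J"
        by (auto simp: ideal_gen_insert ideal_gen_ideal[OF J(1)])
      have eq: "x * (r * v) \<in> J \<longleftrightarrow> x * (s * u) \<in> J" for x
      proof -
        have "x * (r * v) - x * (s * u) \<in> J"
          using ideal_mult[OF J(1) s, of x] by (simp add: right_diff_distrib)
        then show ?thesis
          using ideal_diff[OF J(1), of "x * (r * v)" "x * (r * v) - x * (s * u)"]
            ideal_add[OF J(1), of "x * (r * v) - x * (s * u)" "x * (s * u)"] by auto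
      qed
      have prime_colon: "x \<in> T \<longleftrightarrow> x * (y * w) \<in> J"
        if "prime_ideal T" "T = {r. r * w \<in> J}" "y \<notin> T" for T x y w
      proof -
        have "x * y \<in> T \<longleftrightarrow> x \<in> T"
          using that(1,3) prime_ideal_mult_notin ideal_mult2[OF prime_ideal_ideal] by blast
        moreover have "x * y \<in> T \<longleftrightarrow> x * y * w \<in> J"
          by (subst that(2)) simp
        ultimately show ?thesis
          by (metis mult.assoc)
      qed
      have "s \<notin> P"
        using r(1) eq[of 1] by (auto simp: P(2) Q(2))
      then have "x \<in> Q \<longleftrightarrow> x \<in> P" for x
        using prime_colon[OF Q r(1), of x] prime_colon[OF P, of s x] eq[of x] by simp
      then show ?thesis
        by blast
    qed (use Q in \<open>auto simp: assoc_primes_def\<close>)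
  qed
  then have "assoc_primes J \<subseteq> insert P (assoc_primes ?J)"
    by blast
  then show False
    using fin J(2) finite_subset by blast
qed

section \<open>Depth of localizations\<close>

text \<open>The contraction to \<open>R\<close> of the ideal generated by \<open>B\<close> in
  \<open>R_P\<close>; computations over \<open>R_P\<close> thus take place in \<open>R\<close>,
  without fractions.\<close>

definition loc_ideal :: "'a::comm_ring_1 set \<Rightarrow> 'a set \<Rightarrow> 'a set" where
  "loc_ideal P B = {r. in_loc_ideal P (ideal_gen B) r}"

lemma loc_ideal_iff: "r \<in> loc_ideal P B \<longleftrightarrow> (\<exists>u. u \<notin> P \<and> u * r \<in> ideal_gen B)"
  by (simp add: loc_ideal_def in_loc_ideal_def)

lemma ideal_gen_subset_loc_ideal: "prime_ideal P \<Longrightarrow> ideal_gen B \<subseteq> loc_ideal P B"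
  using prime_ideal_one[of P] by (auto simp: loc_ideal_iff intro!: exI[of _ 1])

lemma is_ideal_loc_ideal:
  assumes "prime_ideal P"
  shows "is_ideal (loc_ideal P B)"
proof (rule is_idealI)
  note ideal = is_ideal_ideal_gen[of B]
  show "0 \<in> loc_ideal P B"
    using ideal_zero[OF ideal] ideal_gen_subset_loc_ideal[OF assms] by blast
  show "a + b \<in> loc_ideal P B" if ab: "a \<in> loc_ideal P B" "b \<in> loc_ideal P B" for a b
  proof -
    obtain u v where u: "u \<notin> P" "u * a \<in> ideal_gen B" and v: "v \<notin> P" "v * b \<in> ideal_gen B"
      using ab by (auto simp: loc_ideal_iff)
    have "v * (u * a) + u * (v * b) \<in> ideal_gen B"
      by (rule ideal_add[OF ideal ideal_mult[OF ideal u(2)] ideal_mult[OF ideal v(2)]])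
    then have "u * v * (a + b) \<in> ideal_gen B"
      by (simp add: algebra_simps)
    then show ?thesis
      using prime_ideal_mult_notin[OF assms u(1) v(1)] by (auto simp: loc_ideal_iff)
  qed
  show "r * a \<in> loc_ideal P B" if a: "a \<in> loc_ideal P B" for r a
  proof -
    obtain u where u: "u \<notin> P" "u * a \<in> ideal_gen B"
      using a by (auto simp: loc_ideal_iff)
    then have "u * (r * a) \<in> ideal_gen B"
      using ideal_mult[OF ideal u(2), of r] by (simp add: mult.left_commute)
    then show ?thesis
      using u(1) by (auto simp: loc_ideal_iff)
  qed
qed

lemma loc_ideal_insert:
  assumes "prime_ideal P"
  shows "r \<in> loc_ideal P (insert a B) \<longleftrightarrow> (\<exists>s c. s \<notin> P \<and> s * r - c * a \<in> loc_ideal P B)"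
proof
  assume "r \<in> loc_ideal P (insert a B)"
  then show "\<exists>s c. s \<notin> P \<and> s * r - c * a \<in> loc_ideal P B"
    using ideal_gen_subset_loc_ideal[OF assms, of B]
    by (auto simp: loc_ideal_iff[of r] ideal_gen_insert)
next
  assume "\<exists>s c. s \<notin> P \<and> s * r - c * a \<in> loc_ideal P B"
  then obtain s c t where *: "s \<notin> P" "t \<notin> P" "t * (s * r - c * a) \<in> ideal_gen B"
    by (auto simp: loc_ideal_iff)
  have "t * s * r - t * c * a \<in> ideal_gen B"
    using *(3) by (simp add: algebra_simps)
  then show "r \<in> loc_ideal P (insert a B)"
    using prime_ideal_mult_notin[OF assms *(2,1)] by (auto simp: loc_ideal_iff ideal_gen_insert)
qed

section \<open>Regular sequences over R_P and Rees' theorem\<close>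

definition loc_nonzerodiv :: "'a::comm_ring_1 set \<Rightarrow> 'a set \<Rightarrow> 'a \<Rightarrow> bool" where
  "loc_nonzerodiv P B a \<longleftrightarrow> (\<forall>r. a * r \<in> loc_ideal P B \<longrightarrow> r \<in> loc_ideal P B)"

text \<open>The socle of \<open>R_P/B R_P\<close> is nonzero, that is, its depth is 0. For the set
  of entries of a regular sequence this says that the sequence is maximal.\<close>

definition loc_socle :: "'a::comm_ring_1 set \<Rightarrow> 'a set \<Rightarrow> bool" where
  "loc_socle P B \<longleftrightarrow> (\<exists>u. u \<notin> loc_ideal P B \<and> (\<forall>p\<in>P. p * u \<in> loc_ideal P B))"

text \<open>The base set \<open>B\<close> collects what has already been divided out, so that
  inductions can factor out a common element.\<close>

fun loc_regular :: "'a::comm_ring_1 set \<Rightarrow> 'a set \<Rightarrow> 'a list \<Rightarrow> bool" where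
  "loc_regular P B [] \<longleftrightarrow> True"
| "loc_regular P B (a # as) \<longleftrightarrow> loc_nonzerodiv P B a \<and> loc_regular P (insert a B) as"

lemma loc_regular_nth:
  "loc_regular P B as \<longleftrightarrow> (\<forall>i<length as. loc_nonzerodiv P (set (take i as) \<union> B) (as ! i))"
  by (induction as arbitrary: B) (simp_all add: All_less_Suc2)

lemma loc_regular_seq_iff: "loc_regular_seq P as \<longleftrightarrow> set as \<subseteq> P \<and> loc_regular P {} as"
  by (simp add: loc_regular_seq_def loc_regular_nth loc_nonzerodiv_def loc_ideal_def)

lemma loc_regular_append:
  "loc_regular P B (as @ bs) \<longleftrightarrow> loc_regular P B as \<and> loc_regular P (set as \<union> B) bs"
  by (induction as arbitrary: B) auto

lemma loc_nonzerodiv_no_socle: "loc_nonzerodiv P B a \<Longrightarrow> a \<in> P \<Longrightarrow> \<not> loc_socle P B"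
  by (auto simp: loc_nonzerodiv_def loc_socle_def)

text \<open>Up to denominators: if \<open>a * r = c * z\<close> modulo \<open>B\<close>, then
  \<open>a\<close> divides \<open>c\<close>, because \<open>z\<close> is a nonzerodivisor modulo
  \<open>a\<close>; cancelling \<open>a\<close> makes \<open>r\<close> a multiple of
  \<open>z\<close>.\<close>

lemma loc_nonzerodiv_insert_swap:
  assumes P: "prime_ideal P" and a: "loc_nonzerodiv P B a" and z: "loc_nonzerodiv P (insert a B) z"
  shows "loc_nonzerodiv P (insert z B) a"
  unfolding loc_nonzerodiv_def
proof (intro allI impI)
  fix r
  note K = is_ideal_loc_ideal[OF P, of B]
  assume "a * r \<in> loc_ideal P (insert z B)"
  then obtain s c where s: "s \<notin> P" "s * (a * r) - c * z \<in> loc_ideal P B"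
    by (auto simp: loc_ideal_insert[OF P])
  have "1 * (z * c) - s * r * a \<in> loc_ideal P B"
    using ideal_mult[OF K s(2), of "- 1"] by (simp add: algebra_simps)
  then have "z * c \<in> loc_ideal P (insert a B)"
    using prime_ideal_one[OF P] unfolding loc_ideal_insert[OF P, of "z * c"] by blast
  then have "c \<in> loc_ideal P (insert a B)"
    using z by (auto simp: loc_nonzerodiv_def)
  then obtain t d where t: "t \<notin> P" "t * c - d * a \<in> loc_ideal P B"
    by (auto simp: loc_ideal_insert[OF P])
  have "t * (s * (a * r) - c * z) + z * (t * c - d * a) \<in> loc_ideal P B"
    by (rule ideal_add[OF K ideal_mult[OF K s(2)] ideal_mult[OF K t(2)]])
  then have "a * (t * s * r - d * z) \<in> loc_ideal P B"
    by (simp add: algebra_simps)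
  then have "t * s * r - d * z \<in> loc_ideal P B"
    using a by (auto simp: loc_nonzerodiv_def)
  then show "r \<in> loc_ideal P (insert z B)"
    using prime_ideal_mult_notin[OF P t(1) s(1)] by (auto simp: loc_ideal_insert[OF P])
qed

text \<open>Moves \<open>z\<close> to the front of a regular sequence by applying the swap at every
  position.\<close>

lemma loc_regular_insert:
  assumes P: "prime_ideal P"
  shows "loc_regular P B as \<Longrightarrow> (\<And>i. i \<le> length as \<Longrightarrow> loc_nonzerodiv P (set (take i as) \<union> B) z)
    \<Longrightarrow> loc_regular P (insert z B) as"
proof (induction as arbitrary: B)
  case (Cons a as)
  have "loc_nonzerodiv P (insert a B) z"
    using Cons.prems(2)[of 1] by simp
  moreover have "loc_nonzerodiv P (set (take i as) \<union> insert a B) z" if "i \<le> length as" for i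
    using Cons.prems(2)[of "Suc i"] that by simp
  ultimately show ?case
    using Cons.IH[of "insert a B"] Cons.prems(1) loc_nonzerodiv_insert_swap[OF P]
    by (simp add: insert_commute)
qed simp

text \<open>If \<open>x\<close> and \<open>y\<close> are nonzerodivisors and \<open>u\<close> is a socle element modulo \<open>x\<close>, then the
  quotient \<open>y u / x\<close> is one modulo \<open>y\<close>.\<close>
lemma loc_socle_swap:
  assumes P: "prime_ideal P" and x: "loc_nonzerodiv P B x" "x \<in> P"
    and y: "loc_nonzerodiv P B y" "y \<in> P" and socle: "loc_socle P (insert x B)"
  shows "loc_socle P (insert y B)"
proof -
  let ?K = "loc_ideal P B"
  note K = is_ideal_loc_ideal[OF P, of B]
  obtain u where u: "u \<notin> loc_ideal P (insert x B)" "\<And>p. p \<in> P \<Longrightarrow> p * u \<in> loc_ideal P (insert x B)"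
    using socle by (auto simp: loc_socle_def)
  obtain s c where s: "s \<notin> P" "s * (y * u) - c * x \<in> ?K"
    using u(2)[OF y(2)] by (auto simp: loc_ideal_insert[OF P])
  have "c \<notin> loc_ideal P (insert y B)"
  proof
    assume "c \<in> loc_ideal P (insert y B)"
    then obtain t d where t: "t \<notin> P" "t * c - d * y \<in> ?K"
      by (auto simp: loc_ideal_insert[OF P])
    have "t * (s * (y * u) - c * x) + x * (t * c - d * y) \<in> ?K"
      by (rule ideal_add[OF K ideal_mult[OF K s(2)] ideal_mult[OF K t(2)]])
    then have "y * (t * s * u - d * x) \<in> ?K"
      by (simp add: algebra_simps)
    then have "t * s * u - d * x \<in> ?K"
      using y by (auto simp: loc_nonzerodiv_def)
    then show False
      using u(1) prime_ideal_mult_notin[OF P t(1) s(1)] by (auto simp: loc_ideal_insert[OF P])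
  qed
  moreover have "p * c \<in> loc_ideal P (insert y B)" if p: "p \<in> P" for p
  proof -
    obtain e w where e: "e \<notin> P" "e * (p * u) - w * x \<in> ?K"
      using u(2)[OF p] by (auto simp: loc_ideal_insert[OF P])
    have "s * y * (e * (p * u) - w * x) - e * p * (s * (y * u) - c * x) \<in> ?K"
      by (rule ideal_diff[OF K ideal_mult[OF K e(2)] ideal_mult[OF K s(2)]])
    then have "x * (e * (p * c) - s * w * y) \<in> ?K"
      by (simp add: algebra_simps)
    then have "e * (p * c) - s * w * y \<in> ?K"
      using x by (auto simp: loc_nonzerodiv_def)
    then show ?thesis
      using e(1) by (auto simp: loc_ideal_insert[OF P])
  qed
  ultimately show ?thesis
    by (auto simp: loc_socle_def)
qed

text \<open>The zero divisors modulo each \<open>loc_ideal P B\<close> are covered by finitely many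
  associated primes, none of which contains \<open>P\<close> when the socle vanishes. Prime
  avoidance then handles all \<open>B\<close> together.\<close>

lemma common_loc_nonzerodiv:
  fixes P :: "'a::comm_ring_1 set"
  assumes noeth: "noetherian_ring TYPE('a)" and P: "prime_ideal P"
    and fin: "finite \<B>" and no_socle: "\<And>B. B \<in> \<B> \<Longrightarrow> \<not> loc_socle P B"
  shows "\<exists>z\<in>P. \<forall>B\<in>\<B>. loc_nonzerodiv P B z"
proof -
  let ?Q = "\<Union>B\<in>\<B>. assoc_primes (loc_ideal P B)"
  note K = is_ideal_loc_ideal[OF P]
  have "finite ?Q"
    using fin finite_assoc_primes[OF noeth K] by blast
  moreover have "prime_ideal Q \<and> \<not> P \<subseteq> Q" if "Q \<in> ?Q" for Q
  proof -
    from that obtain B where B: "B \<in> \<B>" "Q \<in> assoc_primes (loc_ideal P B)"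
      by blast
    then obtain u where Q: "prime_ideal Q" "Q = {r. r * u \<in> loc_ideal P B}"
      by (auto simp: assoc_primes_def)
    have "u \<notin> loc_ideal P B"
      using prime_ideal_one[OF Q(1)] by (simp add: Q(2))
    then show ?thesis
      using Q no_socle[OF B(1)] by (auto simp: loc_socle_def)
  qed
  ultimately have "\<exists>z\<in>P. \<forall>Q\<in>?Q. z \<notin> Q"
    by (rule prime_avoidance[OF _ prime_ideal_ideal[OF P]])
  then obtain z where z: "z \<in> P" "\<forall>Q\<in>?Q. z \<notin> Q" ..
  have "loc_nonzerodiv P B z" if "B \<in> \<B>" for B
    unfolding loc_nonzerodiv_def
  proof (intro allI impI, rule ccontr)
    fix r
    assume r: "z * r \<in> loc_ideal P B" "r \<notin> loc_ideal P B"
    obtain Q where "Q \<in> assoc_primes (loc_ideal P B)" "{x. x * r \<in> loc_ideal P B} \<subseteq> Q"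
      using colon_subset_assoc_prime[OF noeth K r(2)] ..
    then show False
      using z(2) r(1) that by blast
  qed
  then show ?thesis
    using z(1) by blast
qed

lemma loc_regular_prefix_no_socle:
  assumes "loc_regular P B xs" "set xs \<subseteq> P" "i < length xs"
  shows "\<not> loc_socle P (set (take i xs) \<union> B)"
proof (rule loc_nonzerodiv_no_socle)
  show "loc_nonzerodiv P (set (take i xs) \<union> B) (xs ! i)"
    using assms(1,3) by (simp add: loc_regular_nth)
  show "xs ! i \<in> P"
    using assms(2,3) nth_mem by blast
qed

text \<open>Rees: a regular sequence of the length of a maximal one is itself maximal. Both sequences
  are moved to ones starting with a common nonzerodivisor \<open>z\<close>, which is then factored out.\<close>
lemma loc_socle_transfer:
  fixes P :: "'a::comm_ring_1 set"
  assumes noeth: "noetherian_ring TYPE('a)" and P: "prime_ideal P"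
  shows "loc_regular P B xs \<Longrightarrow> loc_regular P B ys \<Longrightarrow> set xs \<subseteq> P \<Longrightarrow> set ys \<subseteq> P
    \<Longrightarrow> length xs = length ys \<Longrightarrow> loc_socle P (set xs \<union> B) \<Longrightarrow> loc_socle P (set ys \<union> B)"
proof (induction xs arbitrary: ys B rule: rev_induct)
  case (snoc x xs)
  obtain y ys' where ys: "ys = ys' @ [y]"
    using snoc.prems(5) by (cases ys rule: rev_cases) auto
  note ysp = snoc.prems(2,4,5)[unfolded ys]
  \<comment> \<open>All these prefixes are proper in the original sequences: \<open>x\<close>
    follows the full \<open>xs\<close> and \<open>y\<close> the full \<open>ys'\<close>. The next
    entry is a nonzerodivisor in \<open>P\<close> and excludes a socle.\<close>
  let ?\<B> = "(\<lambda>i. set (take i xs) \<union> B) ` {..length xs} \<union> (\<lambda>i. set (take i ys') \<union> B) ` {..length ys'}"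
  have "\<not> loc_socle P C" if "C \<in> ?\<B>" for C
    using that loc_regular_prefix_no_socle[OF snoc.prems(1,3)]
      loc_regular_prefix_no_socle[OF ysp(1,2)] by (auto simp: less_Suc_eq_le)
  then obtain z where z: "z \<in> P" "\<forall>C\<in>?\<B>. loc_nonzerodiv P C z"
    using common_loc_nonzerodiv[OF noeth P, of ?\<B>] by auto
  have zx: "loc_nonzerodiv P (set (take i xs) \<union> B) z" if "i \<le> length xs" for i
    using z(2) that by blast
  have zy: "loc_nonzerodiv P (set (take i ys') \<union> B) z" if "i \<le> length ys'" for i
    using z(2) that by blast
  have z': "loc_nonzerodiv P (set xs \<union> B) z" "loc_nonzerodiv P (set ys' \<union> B) z"
    using zx[OF le_refl] zy[OF le_refl] by simp_all
  have x: "loc_nonzerodiv P (set xs \<union> B) x" "loc_regular P B xs"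
    using snoc.prems(1) by (simp_all add: loc_regular_append)
  have y: "loc_nonzerodiv P (set ys' \<union> B) y" "loc_regular P B ys'"
    using ysp(1) by (simp_all add: loc_regular_append)
  \<comment> \<open>Trade the last entry \<open>x\<close> for \<open>z\<close>, apply the induction
    hypothesis with \<open>z\<close> in the base, then trade \<open>z\<close> for
    \<open>y\<close>.\<close>
  have "loc_socle P (set xs \<union> insert z B)"
    using loc_socle_swap[OF P x(1) _ z'(1) z(1)] snoc.prems(3,6) by simp
  moreover have "loc_regular P (insert z B) xs"
    using loc_regular_insert[OF P x(2)] zx by blast
  moreover have "loc_regular P (insert z B) ys'"
    using loc_regular_insert[OF P y(2)] zy by blast
  ultimately have "loc_socle P (set ys' \<union> insert z B)"
    using snoc.prems(3) ysp by (intro snoc.IH[of "insert z B" ys']) auto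
  then show ?case
    using loc_socle_swap[OF P z'(2) z(1), of y] y(1) ysp(2) by (simp add: ys)
qed simp

section \<open>Depth as the common length of maximal regular sequences\<close>

text \<open>If \<open>bs\<close> were longer, its prefix of length \<open>length as\<close> would
  have a socle by \<open>loc_socle_transfer\<close>, which the next entry of \<open>bs\<close>
  forbids.\<close>

lemma loc_regular_seq_length_le:
  fixes P :: "'a::comm_ring_1 set"
  assumes noeth: "noetherian_ring TYPE('a)" and P: "prime_ideal P"
    and as: "loc_regular_seq P as" "loc_socle P (set as)" and bs: "loc_regular_seq P bs"
  shows "length bs \<le> length as"
proof (rule ccontr)
  assume *: "\<not> ?thesis"
  let ?b = "take (length as) bs"
  have reg: "loc_regular P {} bs" "set bs \<subseteq> P"
    using bs by (auto simp: loc_regular_seq_iff)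
  have "loc_regular P {} ?b"
    using reg(1) loc_regular_append[of P "{}" ?b "drop (length as) bs"] by simp
  then have "loc_socle P (set ?b \<union> {})"
    using as reg(2) * set_take_subset[of "length as" bs]
    by (intro loc_socle_transfer[OF noeth P, of "{}" as ?b]) (auto simp: loc_regular_seq_iff)
  then show False
    using loc_regular_prefix_no_socle[OF reg, of "length as"] * by simp
qed

text \<open>The length bound turns the supremum over \<open>nat\<close> into an attained
  maximum.\<close>

lemma depth_loc_eq:
  fixes P :: "'a::comm_ring_1 set"
  assumes "noetherian_ring TYPE('a)" "prime_ideal P" "loc_regular_seq P as" "loc_socle P (set as)"
  shows "depth_loc P = length as"
  unfolding depth_loc_def
  using assms(3) loc_regular_seq_length_le[OF assms] by (intro cSup_eq_maximum) auto

text \<open>Choose a regular sequence whose ideal is maximal among such ideals. Without a socle some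
  nonzerodivisor \<open>z\<close> could be appended; by maximality \<open>z\<close> is already in
  the ideal, so \<open>1\<close> is in it locally, although the ideal lies in
  \<open>P\<close>.\<close>

lemma ex_maximal_loc_regular_seq:
  fixes P :: "'a::comm_ring_1 set"
  assumes noeth: "noetherian_ring TYPE('a)" and P: "prime_ideal P"
  shows "\<exists>as. loc_regular_seq P as \<and> loc_socle P (set as)"
proof -
  let ?F = "{ideal_gen (set as) | as. loc_regular_seq P as}"
  have "\<exists>M\<in>?F. \<forall>I\<in>?F. M \<subseteq> I \<longrightarrow> I = M"
  proof (rule noetherian_max_ideal[OF noeth])
    show "?F \<noteq> {}"
      by (auto simp: loc_regular_seq_iff intro!: exI[of _ "[]"])
  qed (auto simp: is_ideal_ideal_gen)
  then obtain as where as: "loc_regular_seq P as"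
    and max: "\<And>bs. loc_regular_seq P bs \<Longrightarrow> ideal_gen (set as) \<subseteq> ideal_gen (set bs)
      \<Longrightarrow> ideal_gen (set bs) = ideal_gen (set as)"
    by auto
  have "loc_socle P (set as)"
  proof (rule ccontr)
    assume "\<not> loc_socle P (set as)"
    then obtain z where z: "z \<in> P" "loc_nonzerodiv P (set as) z"
      using common_loc_nonzerodiv[OF noeth P, of "{set as}"] by auto
    then have "loc_regular_seq P (as @ [z])"
      using as by (simp add: loc_regular_seq_iff loc_regular_append)
    moreover have "ideal_gen (set as) \<subseteq> ideal_gen (set (as @ [z]))"
      by (rule ideal_gen_mono) auto
    ultimately have "ideal_gen (set (as @ [z])) = ideal_gen (set as)"
      by (rule max)
    then have "z \<in> ideal_gen (set as)"
      using ideal_gen_superset[of "set (as @ [z])"] by auto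
    then have "1 \<in> loc_ideal P (set as)"
      using z(2) ideal_gen_subset_loc_ideal[OF P, of "set as"] by (auto simp: loc_nonzerodiv_def)
    then obtain u where "u \<notin> P" "u \<in> ideal_gen (set as)"
      by (auto simp: loc_ideal_iff)
    then show False
      using ideal_gen_least[OF prime_ideal_ideal[OF P], of "set as"] as
      by (auto simp: loc_regular_seq_iff)
  qed
  then show ?thesis
    using as by blast
qed

lemma length_le_depth_loc:
  fixes P :: "'a::comm_ring_1 set"
  assumes "noetherian_ring TYPE('a)" "prime_ideal P" "loc_regular_seq P bs"
  shows "length bs \<le> depth_loc P"
  using ex_maximal_loc_regular_seq[OF assms(1,2)] loc_regular_seq_length_le[OF assms(1,2) _ _ assms(3)]
    depth_loc_eq[OF assms(1,2)] by metis

text \<open>The primes in question are associated to \<open>R/J\<close>, where \<open>J\<close> is generated by a maximal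
  \<open>R\<close>-regular sequence in \<open>I\<close>.\<close>
lemma finite_min_depth_primes:
  fixes I :: "'a::comm_ring_1 set"
  assumes noeth: "noetherian_ring TYPE('a)" and I: "is_ideal I"
  shows "finite {P \<in> C_set n. I \<subseteq> P \<and> (\<forall>Q\<in>C_set n. I \<subseteq> Q \<longrightarrow> depth_loc P \<le> depth_loc Q)}"
    (is "finite ?M")
proof -
  \<comment> \<open>Regularity over \<open>R\<close> itself, so that one sequence serves all primes
    containing \<open>I\<close>.\<close>
  define reg where "reg as \<longleftrightarrow> set as \<subseteq> I \<and> (\<forall>i<length as. \<forall>r.
    as ! i * r \<in> ideal_gen (set (take i as)) \<longrightarrow> r \<in> ideal_gen (set (take i as)))" for as
  have reg_loc: "loc_regular_seq P as" if as: "reg as" and P: "prime_ideal P" "I \<subseteq> P" for as P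
    unfolding loc_regular_seq_def in_loc_ideal_def
  proof (intro conjI allI impI)
    show "set as \<subseteq> P"
      using as P by (auto simp: reg_def)
    fix i r
    assume i: "i < length as" and "\<exists>u. u \<notin> P \<and> u * (as ! i * r) \<in> ideal_gen (set (take i as))"
    then obtain u where "u \<notin> P" "as ! i * (u * r) \<in> ideal_gen (set (take i as))"
      by (auto simp: mult.left_commute)
    then show "\<exists>u. u \<notin> P \<and> u * r \<in> ideal_gen (set (take i as))"
      using as i by (auto simp: reg_def)
  qed
  show ?thesis
  proof (cases "?M = {}")
    case False
    then obtain P0 where P0: "prime_ideal P0" "I \<subseteq> P0"
      by (auto simp: C_set_def)
    let ?F = "{ideal_gen (set as) | as. reg as}"
    have "\<exists>M\<in>?F. \<forall>I\<in>?F. M \<subseteq> I \<longrightarrow> I = M"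
    proof (rule noetherian_max_ideal[OF noeth])
      show "?F \<noteq> {}"
        by (auto simp: reg_def intro!: exI[of _ "[]"])
    qed (auto simp: is_ideal_ideal_gen)
    then obtain as where as: "reg as"
      and max: "\<And>bs. reg bs \<Longrightarrow> ideal_gen (set as) \<subseteq> ideal_gen (set bs)
        \<Longrightarrow> ideal_gen (set bs) = ideal_gen (set as)"
      by auto
    let ?J = "ideal_gen (set as)"
    note J = is_ideal_ideal_gen[of "set as"]
    have asI: "set as \<subseteq> I"
      using as by (simp add: reg_def)
    then have JI: "?J \<subseteq> I"
      by (rule ideal_gen_least[OF I])
    \<comment> \<open>Otherwise prime avoidance gives a nonzerodivisor modulo \<open>?J\<close>
      inside \<open>I\<close>. Maximality puts it into \<open>?J\<close>, which forces
      \<open>1\<close> into \<open>?J\<close> and hence into \<open>P0\<close>.\<close>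
    have "\<exists>Q\<in>assoc_primes ?J. I \<subseteq> Q"
    proof (rule ccontr)
      assume *: "\<not> ?thesis"
      have "\<exists>z\<in>I. \<forall>Q\<in>assoc_primes ?J. z \<notin> Q"
        using * by (intro prime_avoidance[OF finite_assoc_primes[OF noeth J] I])
          (auto simp: assoc_primes_def)
      then obtain z where z: "z \<in> I" "\<forall>Q\<in>assoc_primes ?J. z \<notin> Q" ..
      have nzd: "r \<in> ?J" if "z * r \<in> ?J" for r
        using colon_subset_assoc_prime[OF noeth J, of r] z(2) that by blast
      then have "reg (as @ [z])"
        using as z(1) by (auto simp: reg_def nth_append less_Suc_eq)
      moreover have "?J \<subseteq> ideal_gen (set (as @ [z]))"
        by (rule ideal_gen_mono) auto
      ultimately have "ideal_gen (set (as @ [z])) = ?J"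
        by (rule max)
      then have "z \<in> ?J"
        using ideal_gen_superset[of "set (as @ [z])"] by auto
      then have "1 \<in> P0"
        using nzd[of 1] JI P0(2) by auto
      then show False
        using prime_ideal_one[OF P0(1)] by simp
    qed
    then obtain Q u where Q: "prime_ideal Q" "I \<subseteq> Q" "Q = {r. r * u \<in> ?J}"
      by (auto simp: assoc_primes_def)
    have "u \<notin> loc_ideal Q (set as)"
      using Q(3) by (auto simp: loc_ideal_iff)
    then have "loc_socle Q (set as)"
      using Q(3) ideal_gen_subset_loc_ideal[OF Q(1), of "set as"] unfolding loc_socle_def by blast
    then have depth_Q: "depth_loc Q = length as"
      by (rule depth_loc_eq[OF noeth Q(1) reg_loc[OF as Q(1,2)]])
    have "P \<in> assoc_primes ?J" if "P \<in> ?M" for P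
    proof -
      have P: "prime_ideal P" "I \<subseteq> P" "depth_loc P \<le> n"
        and min: "\<And>Q. Q \<in> C_set n \<Longrightarrow> I \<subseteq> Q \<Longrightarrow> depth_loc P \<le> depth_loc Q"
        using that by (auto simp: C_set_def)
      note regP = reg_loc[OF as P(1,2)]
      \<comment> \<open>\<open>Q\<close> competes for minimal depth only if it lies in
        \<open>C_set n\<close>; a depth of \<open>P\<close> above \<open>length as\<close> would
        guarantee this.\<close>
      have "depth_loc P \<le> length as"
      proof (rule ccontr)
        assume *: "\<not> ?thesis"
        then have "Q \<in> C_set n"
          using depth_Q P(3) Q(1) by (simp add: C_set_def)
        then show False
          using min[OF _ Q(2)] depth_Q * by simp
      qed
      have "loc_socle P (set as)"
      proof (rule ccontr)
        assume "\<not> loc_socle P (set as)"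
        then obtain z where z: "z \<in> P" "loc_nonzerodiv P (set as) z"
          using common_loc_nonzerodiv[OF noeth P(1), of "{set as}"] by auto
        then have "loc_regular_seq P (as @ [z])"
          using regP by (simp add: loc_regular_seq_iff loc_regular_append)
        then show False
          using length_le_depth_loc[OF noeth P(1)] \<open>depth_loc P \<le> length as\<close> by fastforce
      qed
      then obtain v where v: "v \<notin> loc_ideal P (set as)" "\<And>p. p \<in> P \<Longrightarrow> p * v \<in> loc_ideal P (set as)"
        by (auto simp: loc_socle_def)
      \<comment> \<open>\<open>P\<close> kills \<open>v\<close> only locally. Clearing the
        denominators for finitely many generators of \<open>P\<close> yields \<open>t\<close>
        outside \<open>P\<close> such that \<open>P\<close> is the exact annihilator of
        \<open>t * v\<close> modulo \<open>?J\<close>.\<close>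
      obtain S where S: "finite S" "P = ideal_gen S"
        using noeth prime_ideal_ideal[OF P(1)] unfolding noetherian_ring_def by meson
      have "\<forall>p\<in>S. \<exists>s. s \<notin> P \<and> s * (p * v) \<in> ?J"
        using v(2) ideal_gen_superset[of S] S(2) by (auto simp: loc_ideal_iff)
      then obtain s where s: "\<And>p. p \<in> S \<Longrightarrow> s p \<notin> P \<and> s p * (p * v) \<in> ?J"
        by metis
      define t where "t = (\<Prod>p\<in>S. s p)"
      have t: "t \<notin> P"
        unfolding t_def using s by (intro prime_ideal_prod_notin[OF P(1)]) auto
      have "S \<subseteq> {r. r * (t * v) \<in> ?J}"
      proof
        fix p
        assume p: "p \<in> S"
        have "t * (p * v) = (\<Prod>q\<in>S - {p}. s q) * (s p * (p * v))"
          unfolding t_def using prod.remove[OF S(1) p, of s] by (simp add: mult_ac)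
        then have "t * (p * v) \<in> ?J"
          using ideal_mult[OF J] s[OF p] by simp
        then show "p \<in> {r. r * (t * v) \<in> ?J}"
          by (simp add: mult.left_commute)
      qed
      then have "P \<subseteq> {r. r * (t * v) \<in> ?J}"
        unfolding S(2) by (rule ideal_gen_least[OF is_ideal_colon[OF J]])
      moreover have "r \<in> P" if "r * (t * v) \<in> ?J" for r
      proof (rule ccontr)
        assume "r \<notin> P"
        then have "r * t \<notin> P"
          using t by (rule prime_ideal_mult_notin[OF P(1)])
        then show False
          using v(1) that by (auto simp: loc_ideal_iff mult.assoc)
      qed
      ultimately have "P = {r. r * (t * v) \<in> ?J}"
        by blast
      then show ?thesis
        using P(1) unfolding assoc_primes_def by blast
    qed
    then have "?M \<subseteq> assoc_primes ?J"
      by blast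
    then show ?thesis
      using finite_assoc_primes[OF noeth J] by (rule finite_subset)
  qed (metis finite.emptyI)
qed

section \<open>Generators of localized modules\<close>

context module
begin

lemma mu_loc_le:
  assumes "finite S" "\<And>m. \<exists>s. s \<notin> P \<and> s *s m \<in> span (S \<union> N)"
  shows "mu_loc scale P N \<le> card S"
  unfolding mu_loc_def using assms by (intro Least_le) blast

text \<open>The \<open>LEAST\<close> is attained, since global generators generate every
  localization.\<close>

lemma mu_loc_witness:
  assumes fg: "finitely_generated_module scale" and P: "prime_ideal P"
  obtains S where "finite S" "card S = mu_loc scale P N" "\<And>m. \<exists>s. s \<notin> P \<and> s *s m \<in> span (S \<union> N)"
proof -
  obtain G where G: "finite G" "span G = UNIV"
    using fg by (auto simp: finitely_generated_module_def)
  have "1 *s m \<in> span (G \<union> N)" for m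
    using G(2) span_mono[of G "G \<union> N"] by auto
  then have "\<exists>S. finite S \<and> card S = card G \<and> (\<forall>m. \<exists>s. s \<notin> P \<and> s *s m \<in> span (S \<union> N))"
    using G(1) prime_ideal_one[OF P] by blast
  then have "\<exists>S. finite S \<and> card S = mu_loc scale P N \<and> (\<forall>m. \<exists>s. s \<notin> P \<and> s *s m \<in> span (S \<union> N))"
    unfolding mu_loc_def by (rule LeastI)
  then show thesis
    using that by blast
qed

lemma uniform_denominator:
  assumes P: "prime_ideal P" and W: "subspace W" and G: "finite G"
    and den: "\<And>g. g \<in> G \<Longrightarrow> \<exists>s. s \<notin> P \<and> s *s g \<in> W"
  shows "\<exists>s. s \<notin> P \<and> (\<forall>m\<in>span G. s *s m \<in> W)"
proof -
  obtain s where s: "\<And>g. g \<in> G \<Longrightarrow> s g \<notin> P \<and> s g *s g \<in> W"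
    using den by metis
  define t where "t = (\<Prod>g\<in>G. s g)"
  have "t *s g \<in> W" if g: "g \<in> G" for g
  proof -
    have "t *s g = (\<Prod>h\<in>G - {g}. s h) *s (s g *s g)"
      unfolding t_def using prod.remove[OF G g, of s] by (simp add: mult.commute)
    then show ?thesis
      using s[OF g] subspace_scale[OF W] by metis
  qed
  moreover have "subspace {m. t *s m \<in> W}"
    using subspace_0[OF W] subspace_add[OF W] subspace_scale[OF W]
    by (intro subspaceI) (auto simp: scale_right_distrib scale_left_commute[of t] simp del: scale_scale)
  ultimately have "span G \<subseteq> {m. t *s m \<in> W}"
    by (intro span_minimal) auto
  moreover have "t \<notin> P"
    unfolding t_def using s by (intro prime_ideal_prod_notin[OF P]) auto
  ultimately show ?thesis
    by blast
qed

text \<open>The preimage in \<open>M\<close> of the subspace spanned by \<open>A\<close> in the fibre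
  \<open>M\<^sub>P/PM\<^sub>P\<close>.\<close>
definition fibre_span :: "'a set \<Rightarrow> 'b set \<Rightarrow> 'b set" where
  "fibre_span P A = {m. \<exists>s. s \<notin> P \<and> s *s m \<in> span (A \<union> {p *s m | p m. p \<in> P})}"

lemma span_subset_fibre_span:
  assumes "prime_ideal P"
  shows "span (A \<union> {p *s m | p m. p \<in> P}) \<subseteq> fibre_span P A"
  using prime_ideal_one[OF assms] by (auto simp: fibre_span_def intro!: exI[of _ 1])

lemma subset_fibre_span: "prime_ideal P \<Longrightarrow> A \<subseteq> fibre_span P A"
  using span_subset_fibre_span[of P A] span_superset by blast

lemma scale_in_fibre_span: "prime_ideal P \<Longrightarrow> p \<in> P \<Longrightarrow> p *s m \<in> fibre_span P A"
  by (rule subsetD[OF span_subset_fibre_span]) (auto intro: span_base)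

lemma fibre_span_mono: "A \<subseteq> B \<Longrightarrow> fibre_span P A \<subseteq> fibre_span P B"
  unfolding fibre_span_def using span_mono[of "A \<union> X" "B \<union> X" for X] by blast

lemma subspace_fibre_span:
  assumes P: "prime_ideal P"
  shows "subspace (fibre_span P A)"
proof (rule subspaceI)
  let ?X = "span (A \<union> {p *s m | p m. p \<in> P})"
  show "0 \<in> fibre_span P A"
    using span_subset_fibre_span[OF P] span_zero by blast
  show "x + y \<in> fibre_span P A" if xy: "x \<in> fibre_span P A" "y \<in> fibre_span P A" for x y
  proof -
    obtain s t where s: "s \<notin> P" "s *s x \<in> ?X" and t: "t \<notin> P" "t *s y \<in> ?X"
      using xy unfolding fibre_span_def by blast
    have "t *s (s *s x) + s *s (t *s y) \<in> ?X"
      by (rule span_add[OF span_scale[OF s(2)] span_scale[OF t(2)]])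
    then have "(s * t) *s (x + y) \<in> ?X"
      by (simp add: scale_right_distrib mult.commute)
    then show ?thesis
      using prime_ideal_mult_notin[OF P s(1) t(1)] unfolding fibre_span_def by blast
  qed
  show "c *s x \<in> fibre_span P A" if x: "x \<in> fibre_span P A" for c x
  proof -
    obtain s where s: "s \<notin> P" "s *s x \<in> ?X"
      using x unfolding fibre_span_def by blast
    then have "s *s (c *s x) \<in> ?X"
      using span_scale[OF s(2), of c] by (simp add: mult.commute)
    then show ?thesis
      using s(1) unfolding fibre_span_def by blast
  qed
qed

lemma fibre_span_cancel:
  assumes P: "prime_ideal P" and "s \<notin> P" "s *s x \<in> fibre_span P A"
  shows "x \<in> fibre_span P A"
  using assms prime_ideal_mult_notin[OF P] unfolding fibre_span_def by fastforce

lemma fibre_span_subset: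
  assumes P: "prime_ideal P" and A: "A \<subseteq> fibre_span P B"
  shows "fibre_span P A \<subseteq> fibre_span P B"
proof
  fix x
  assume "x \<in> fibre_span P A"
  then obtain s where s: "s \<notin> P" "s *s x \<in> span (A \<union> {p *s m | p m. p \<in> P})"
    unfolding fibre_span_def by blast
  have "span (A \<union> {p *s m | p m. p \<in> P}) \<subseteq> fibre_span P B"
    using A scale_in_fibre_span[OF P] by (intro span_minimal subspace_fibre_span[OF P]) auto
  then show "x \<in> fibre_span P B"
    using s fibre_span_cancel[OF P] by blast
qed

lemma span_le_fibre_span: "prime_ideal P \<Longrightarrow> span A \<subseteq> fibre_span P A"
  by (rule span_minimal[OF subset_fibre_span subspace_fibre_span])

text \<open>The coefficient of \<open>t\<close> cannot lie in \<open>P\<close>, as \<open>x\<close>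
  would then be in the span of \<open>A\<close> alone; hence it is invertible in the residue
  field.\<close>

lemma fibre_span_exchange:
  assumes P: "prime_ideal P" and x: "x \<in> fibre_span P (insert t A)" "x \<notin> fibre_span P A"
  shows "t \<in> fibre_span P (insert x A)"
proof -
  let ?PM = "{p *s m | p m. p \<in> P}"
  obtain s c where s: "s \<notin> P" "s *s x - c *s t \<in> span (A \<union> ?PM)"
    using x(1) by (auto simp: fibre_span_def span_insert)
  have diff: "s *s x - c *s t \<in> fibre_span P A"
    using s(2) span_subset_fibre_span[OF P] by blast
  note sub = subspace_fibre_span[OF P]
  have "c \<notin> P"
  proof
    assume "c \<in> P"
    then have "s *s x - c *s t + c *s t \<in> fibre_span P A"
      by (intro subspace_add[OF sub diff] scale_in_fibre_span[OF P])
    then show False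
      using fibre_span_cancel[OF P s(1)] x(2) by simp
  qed
  moreover have "s *s x - (s *s x - c *s t) \<in> fibre_span P (insert x A)"
  proof (rule subspace_diff[OF sub])
    show "s *s x \<in> fibre_span P (insert x A)"
      using subset_fibre_span[OF P, of "insert x A"] subspace_scale[OF sub] by blast
    show "s *s x - c *s t \<in> fibre_span P (insert x A)"
      using diff fibre_span_mono[of A "insert x A" P] by blast
  qed
  ultimately show ?thesis
    using fibre_span_cancel[OF P] by simp
qed

section \<open>Nakayama's lemma and its consequences for \<open>mu_loc\<close>\<close>

text \<open>Adjoin global generators to \<open>A\<close> and discard them one by one. The relation
  for \<open>g\<close> modulo \<open>P M\<close> is solved for \<open>g\<close>: its total
  coefficient \<open>s * r - p\<close> is outside \<open>P\<close>.\<close>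

lemma nakayama:
  assumes fg: "finitely_generated_module scale" and P: "prime_ideal P"
    and A: "fibre_span P A = UNIV"
  shows "\<exists>s. s \<notin> P \<and> (\<forall>m. s *s m \<in> span A)"
proof -
  have "\<exists>s. s \<notin> P \<and> (\<forall>m. s *s m \<in> span A)"
    if "finite G" "\<exists>s. s \<notin> P \<and> (\<forall>m. s *s m \<in> span (A \<union> G))" for G
    using that
  proof (induction G)
    case (insert g G)
    obtain s where s: "s \<notin> P" "\<And>m. s *s m \<in> span (insert g (A \<union> G))"
      using insert.prems by auto
    obtain r where r: "r \<notin> P" "r *s g \<in> span (A \<union> {p *s m | p m. p \<in> P})"
      using A unfolding fibre_span_def by blast
    \<comment> \<open>After multiplication by \<open>s\<close>, elements of \<open>P M\<close> are
      expressed through \<open>A\<close>, \<open>G\<close> and \<open>g\<close>; all occurrences of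
      \<open>g\<close> are gathered in one coefficient \<open>p\<close> from
      \<open>P\<close>.\<close>
    have "\<exists>p\<in>P. s *s (r *s g) - p *s g \<in> span (A \<union> G)"
      using r(2)
    proof (induction rule: span_induct_alt)
      case base
      then show ?case
        using ideal_zero[OF prime_ideal_ideal[OF P]] span_zero by (intro bexI[of _ 0]) auto
    next
      case (step c x y)
      then obtain q where q: "q \<in> P" "s *s y - q *s g \<in> span (A \<union> G)"
        by blast
      have "\<exists>p\<in>P. s *s x - p *s g \<in> span (A \<union> G)"
        using step.hyps
      proof
        assume "x \<in> A"
        then show ?thesis
          using ideal_zero[OF prime_ideal_ideal[OF P]] by (intro bexI[of _ 0]) (auto intro: span_scale span_base)
      next
        assume "x \<in> {p *s m | p m. p \<in> P}"
        then obtain p m where p: "p \<in> P" "x = p *s m"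
          by blast
        obtain k where "s *s m - k *s g \<in> span (A \<union> G)"
          using s(2)[of m] by (auto simp: span_insert)
        then have "p *s (s *s m - k *s g) \<in> span (A \<union> G)"
          by (rule span_scale)
        then have "s *s x - (p * k) *s g \<in> span (A \<union> G)"
          by (simp add: p(2) scale_right_diff_distrib mult.commute)
        then show ?thesis
          using ideal_mult2[OF prime_ideal_ideal[OF P] p(1)] by blast
      qed
      then obtain p where p: "p \<in> P" "s *s x - p *s g \<in> span (A \<union> G)" ..
      have "c *s (s *s x - p *s g) + (s *s y - q *s g) \<in> span (A \<union> G)"
        using p q by (intro span_add span_scale)
      then have "s *s (c *s x + y) - (c * p + q) *s g \<in> span (A \<union> G)"
        by (simp add: algebra_simps)
      then show ?case
        using p(1) q(1) prime_ideal_ideal[OF P] by (blast intro: ideal_add ideal_mult)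
    qed
    then obtain p where p: "p \<in> P" "s *s (r *s g) - p *s g \<in> span (A \<union> G)" ..
    define t where "t = s * r - p"
    have t: "t \<notin> P"
      using prime_ideal_mult_notin[OF P s(1) r(1)] ideal_add[OF prime_ideal_ideal[OF P] _ p(1), of t]
      by (auto simp: t_def)
    have tg: "t *s g \<in> span (A \<union> G)"
      using p(2) by (simp add: t_def scale_left_diff_distrib)
    have "(t * s) *s m \<in> span (A \<union> G)" for m
    proof -
      obtain k where "s *s m - k *s g \<in> span (A \<union> G)"
        using s(2)[of m] by (auto simp: span_insert)
      then have "t *s (s *s m - k *s g) + k *s (t *s g) \<in> span (A \<union> G)"
        by (rule span_add[OF span_scale span_scale[OF tg]])
      then show ?thesis
        by (simp add: scale_right_diff_distrib mult.commute)
    qed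
    then show ?case
      using insert.IH prime_ideal_mult_notin[OF P t s(1)] by blast
  qed simp
  moreover obtain G where G: "finite G" "span G = UNIV"
    using fg by (auto simp: finitely_generated_module_def)
  moreover have "1 *s m \<in> span (A \<union> G)" for m
    using G(2) span_mono[of G "A \<union> G"] by auto
  ultimately show ?thesis
    using prime_ideal_one[OF P] by blast
qed

lemma mu_loc_le_fibre:
  assumes "finitely_generated_module scale" "prime_ideal P" "finite S" "fibre_span P (S \<union> N) = UNIV"
  shows "mu_loc scale P N \<le> card S"
  using nakayama[OF assms(1,2,4)] assms(3) by (intro mu_loc_le) auto

lemma mu_loc_fibre_witness:
  assumes "finitely_generated_module scale" "prime_ideal P"
  obtains S where "finite S" "card S = mu_loc scale P N" "fibre_span P (S \<union> N) = UNIV"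
proof -
  obtain S where S: "finite S" "card S = mu_loc scale P N" "\<And>m. \<exists>s. s \<notin> P \<and> s *s m \<in> span (S \<union> N)"
    by (rule mu_loc_witness[OF assms]) blast
  have "m \<in> fibre_span P (S \<union> N)" for m
    using S(3)[of m] span_le_fibre_span[OF assms(2)] fibre_span_cancel[OF assms(2)] by blast
  then show thesis
    using that S by blast
qed

text \<open>By Nakayama only the images in the fibre matter, so it suffices that \<open>N\<close>
  lies in the span of \<open>N'\<close> there.\<close>

lemma mu_loc_antimono:
  assumes fg: "finitely_generated_module scale" and P: "prime_ideal P" and N: "N \<subseteq> fibre_span P N'"
  shows "mu_loc scale P N' \<le> mu_loc scale P N"
proof -
  obtain S where S: "finite S" "card S = mu_loc scale P N" "fibre_span P (S \<union> N) = UNIV"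
    by (rule mu_loc_fibre_witness[OF fg P])
  have "S \<union> N \<subseteq> fibre_span P (S \<union> N')"
    using N subset_fibre_span[OF P, of "S \<union> N'"] fibre_span_mono[of N' "S \<union> N'" P] by blast
  then have "fibre_span P (S \<union> N') = UNIV"
    using fibre_span_subset[OF P] S(3) by blast
  then show ?thesis
    using mu_loc_le_fibre[OF fg P S(1)] S(2) by simp
qed

lemma mu_loc_insert:
  assumes fg: "finitely_generated_module scale" and P: "prime_ideal P" and N: "N \<subseteq> span (insert z N')"
  shows "mu_loc scale P N' \<le> mu_loc scale P N + 1"
proof -
  obtain S where S: "finite S" "card S = mu_loc scale P N" "\<And>m. \<exists>s. s \<notin> P \<and> s *s m \<in> span (S \<union> N)"
    by (rule mu_loc_witness[OF fg P]) blast
  have "S \<union> N \<subseteq> span (insert z S \<union> N')"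
    using N span_mono[of "insert z N'" "insert z S \<union> N'"] span_superset[of "insert z S \<union> N'"] by auto
  then have "span (S \<union> N) \<subseteq> span (insert z S \<union> N')"
    by (rule span_minimal) simp
  then have "mu_loc scale P N' \<le> card (insert z S)"
    using S(1,3) by (intro mu_loc_le) blast+
  also have "\<dots> \<le> card S + 1"
    using S(1) by (simp add: card_insert_if)
  finally show ?thesis
    using S(2) by simp
qed

text \<open>Add the elements of \<open>T\<close> to \<open>A\<close> one at a time; the one that
  first brings \<open>x\<close> into the span can be exchanged for \<open>x\<close>.\<close>

lemma fibre_span_remove:
  assumes P: "prime_ideal P" and "finite T" "x \<in> fibre_span P (T \<union> A)" "x \<notin> fibre_span P A"
  shows "\<exists>t\<in>T. t \<in> fibre_span P (insert x (T - {t} \<union> A))"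
  using assms(2,3)
proof (induction T)
  case (insert t T)
  show ?case
  proof (cases "x \<in> fibre_span P (T \<union> A)")
    case True
    then obtain t' where t': "t' \<in> T" "t' \<in> fibre_span P (insert x (T - {t'} \<union> A))"
      using insert.IH by blast
    then show ?thesis
      using fibre_span_mono[of "insert x (T - {t'} \<union> A)" "insert x (insert t T - {t'} \<union> A)" P] by blast
  next
    case False
    then have "t \<in> fibre_span P (insert x (T \<union> A))"
      using insert.prems by (intro fibre_span_exchange[OF P _ False]) simp
    then show ?thesis
      using insert.hyps by (intro bexI[of _ t]) auto
  qed
qed (use assms(4) in simp)

section \<open>Linear independence in the fibre\<close>

text \<open>Linear independence over the residue field of \<open>P\<close>. In this ordered form a
  dependence always singles out an entry that depends on later entries.\<close>

fun fibre_indep :: "'a set \<Rightarrow> 'b list \<Rightarrow> bool" where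
  "fibre_indep P [] \<longleftrightarrow> True"
| "fibre_indep P (x # xs) \<longleftrightarrow> x \<notin> fibre_span P (set xs) \<and> fibre_indep P xs"

lemma steinitz:
  assumes P: "prime_ideal P" and S: "finite S" "fibre_span P S = UNIV"
  shows "fibre_indep P xs \<Longrightarrow>
    \<exists>T. finite T \<and> card T + length xs = card S \<and> fibre_span P (T \<union> set xs) = UNIV"
proof (induction xs)
  case (Cons x xs)
  then obtain T where T: "finite T" "card T + length xs = card S" "fibre_span P (T \<union> set xs) = UNIV"
    by auto
  obtain t where t: "t \<in> T" "t \<in> fibre_span P (insert x (T - {t} \<union> set xs))"
    using fibre_span_remove[OF P T(1), of x "set xs"] T(3) Cons.prems by auto
  have "T \<union> set xs \<subseteq> fibre_span P (insert x (T - {t} \<union> set xs))"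
    using t(2) subset_fibre_span[OF P, of "insert x (T - {t} \<union> set xs)"] by blast
  then have "fibre_span P (insert x (T - {t} \<union> set xs)) = UNIV"
    using fibre_span_subset[OF P] T(3) by blast
  moreover have "card (T - {t}) + length (x # xs) = card S"
    using T(1,2) t(1) card_Suc_Diff1[OF T(1) t(1)] by simp
  ultimately show ?case
    using T(1) by (intro exI[of _ "T - {t}"]) simp
qed (use S in auto)

text \<open>By Steinitz the list replaces equally many members of a minimal generating set, and the
  remaining members generate the quotient.\<close>

lemma mu_loc_fibre_indep:
  assumes fg: "finitely_generated_module scale" and P: "prime_ideal P" and xs: "fibre_indep P xs"
  shows "mu_loc scale P (span (set xs)) + length xs \<le> mu_loc scale P {}"
proof -
  obtain S where S: "finite S" "card S = mu_loc scale P {}" "fibre_span P (S \<union> {}) = UNIV"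
    by (rule mu_loc_fibre_witness[OF fg P])
  then obtain T where T: "finite T" "card T + length xs = card S" "fibre_span P (T \<union> set xs) = UNIV"
    using steinitz[OF P S(1) _ xs] by auto
  have "fibre_span P (T \<union> span (set xs)) = UNIV"
    using T(3) fibre_span_mono[of "T \<union> set xs" "T \<union> span (set xs)" P] span_superset[of "set xs"] by blast
  then show ?thesis
    using mu_loc_le_fibre[OF fg P T(1)] T(2) S(2) by fastforce
qed

lemma not_fibre_indep_nth:
  "\<not> fibre_indep P xs \<Longrightarrow> \<exists>i<length xs. xs ! i \<in> fibre_span P (set (drop (Suc i) xs))"
proof (induction xs)
  case (Cons x xs)
  show ?case
  proof (cases "x \<in> fibre_span P (set xs)")
    case False
    then obtain i where "i < length xs" "xs ! i \<in> fibre_span P (set (drop (Suc i) xs))"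
      using Cons by auto
    then show ?thesis
      by (intro exI[of _ "Suc i"]) simp
  qed (intro exI[of _ 0], simp)
qed simp

section \<open>Shifting generators by multiples of one of them\<close>

abbreviation shifted :: "'b \<Rightarrow> 'b list \<Rightarrow> 'b list \<Rightarrow> bool" where
  "shifted z \<equiv> list_all2 (\<lambda>y y'. \<exists>a. y' = y + a *s z)"

lemma shifted_refl: "shifted z ys ys"
  by (rule list_all2_refl) (auto intro: exI[of _ 0])

lemma shifted_span:
  assumes "shifted z ys ys'"
  shows "set ys' \<subseteq> span (insert z (set ys))" "set ys \<subseteq> span (insert z (set ys'))"
proof -
  show "set ys' \<subseteq> span (insert z (set ys))"
  proof
    fix y'
    assume "y' \<in> set ys'"
    then obtain i where "i < length ys'" "y' = ys' ! i"
      by (auto simp: in_set_conv_nth)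
    then obtain a where "y' = ys ! i + a *s z" "i < length ys"
      using assms by (auto simp: list_all2_conv_all_nth)
    then show "y' \<in> span (insert z (set ys))"
      by (simp add: span_add span_scale span_base)
  qed
  have *: "y \<in> span (insert z B)" if "y + a *s z \<in> B" for a y B
  proof -
    have "y + a *s z - a *s z \<in> span (insert z B)"
      using that by (intro span_diff span_scale span_base) auto
    then show ?thesis
      by simp
  qed
  show "set ys \<subseteq> span (insert z (set ys'))"
  proof
    fix y
    assume "y \<in> set ys"
    then obtain i where "i < length ys" "y = ys ! i"
      by (auto simp: in_set_conv_nth)
    then obtain a where "ys' ! i = y + a *s z" "i < length ys'"
      using assms by (auto simp: list_all2_conv_all_nth)
    then show "y \<in> span (insert z (set ys'))"
      using *[of y a "set ys'"] nth_mem[of i ys'] by simp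
  qed
qed

text \<open>The primes are treated one at a time, minimal ones last, so that the coefficient used at
  \<open>P\<close> can be chosen inside all the primes treated before.\<close>
lemma ex_shifted_same_fibre_span:
  assumes fg: "finitely_generated_module scale" and "finite \<E>"
    and "\<And>P. P \<in> \<E> \<Longrightarrow> prime_ideal P"
    and "\<And>P. P \<in> \<E> \<Longrightarrow> mu_loc scale P {} < mu_loc scale P (span (insert z (set ys))) + length ys + 1"
  shows "\<exists>ys'. shifted z ys ys' \<and> (\<forall>P\<in>\<E>. z \<in> fibre_span P (set ys'))"
  using assms(2-)
proof (induction \<E> rule: finite_remove_minimal_induct)
  case empty
  then show ?case
    using shifted_refl by blast
next
  case (remove \<E> P)
  then obtain ys' where ys': "shifted z ys ys'" "\<And>Q. Q \<in> \<E> - {P} \<Longrightarrow> z \<in> fibre_span Q (set ys')"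
    by auto
  have P: "prime_ideal P"
    using remove by blast
  show ?case
  proof (cases "z \<in> fibre_span P (set ys')")
    case False
    have "span (insert z (set ys')) = span (insert z (set ys))"
      using shifted_span[OF ys'(1)] span_superset[of "insert z _"]
      by (intro antisym span_minimal) auto
    \<comment> \<open>By the bound on \<open>mu_loc\<close>, \<open>z # ys'\<close> is too long to
      be independent. Since \<open>z\<close> is outside the span of \<open>ys'\<close>, some entry
      of \<open>ys'\<close> depends on later ones; that entry will carry the shift.\<close>
    then have "\<not> fibre_indep P (z # ys')"
      using mu_loc_fibre_indep[OF fg P, of "z # ys'"] remove.prems(2)[OF remove.hyps(2)]
        list_all2_lengthD[OF ys'(1)] by auto
    then obtain i where i: "i < length ys'" "ys' ! i \<in> fibre_span P (set (drop (Suc i) ys'))"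
      using False not_fibre_indep_nth[of P ys'] by auto
    have "is_ideal Q \<and> \<not> Q \<subseteq> P" if "Q \<in> \<E> - {P}" for Q
      using remove.hyps(3)[OF that] remove.prems(1)[of Q] prime_ideal_ideal that by blast
    then obtain a where a: "a \<notin> P" "\<And>Q. Q \<in> \<E> - {P} \<Longrightarrow> a \<in> Q"
      using exists_outside_prime[OF finite_Diff[OF remove.hyps(1)] P, of "{P}"] by blast
    define zs where "zs = ys'[i := ys' ! i + a *s z]"
    have zs_i: "ys' ! i + a *s z \<in> set zs"
      unfolding zs_def by (rule set_update_memI[OF i(1)])
    have "shifted z ys zs"
      unfolding list_all2_conv_all_nth
    proof (intro conjI allI impI)
      show "length ys = length zs"
        using list_all2_lengthD[OF ys'(1)] by (simp add: zs_def)
      fix j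
      assume j: "j < length ys"
      then obtain b where b: "ys' ! j = ys ! j + b *s z"
        using list_all2_nthD[OF ys'(1)] by blast
      show "\<exists>a. zs ! j = ys ! j + a *s z"
      proof (cases "j = i")
        case True
        then show ?thesis
          using i(1) b by (intro exI[of _ "b + a"]) (simp add: zs_def scale_left_distrib add.assoc)
      qed (use b in \<open>auto simp: zs_def\<close>)
    qed
    \<comment> \<open>The old entry is in the span of later entries, which are unchanged.
      Subtracting it from the new entry leaves \<open>a *s z\<close>, and \<open>a\<close> is
      outside \<open>P\<close>.\<close>
    moreover have "z \<in> fibre_span P (set zs)"
    proof (rule fibre_span_cancel[OF P a(1)])
      have "set (drop (Suc i) ys') \<subseteq> set zs"
        using set_drop_subset[of "Suc i" zs] by (simp add: zs_def)
      then have "ys' ! i \<in> fibre_span P (set zs)"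
        using i(2) fibre_span_mono by blast
      then have "ys' ! i + a *s z - ys' ! i \<in> fibre_span P (set zs)"
        using zs_i subset_fibre_span[OF P, of "set zs"]
        by (intro subspace_diff[OF subspace_fibre_span[OF P]]) auto
      then show "a *s z \<in> fibre_span P (set zs)"
        by simp
    qed
    \<comment> \<open>Here \<open>a\<close> lies in \<open>Q\<close>, so the shift is invisible in
      the fibre at \<open>Q\<close>.\<close>
    moreover have "z \<in> fibre_span Q (set zs)" if Q: "Q \<in> \<E> - {P}" for Q
    proof -
      have prime_Q: "prime_ideal Q"
        using Q remove.prems(1) by blast
      have "y \<in> fibre_span Q (set zs)" if y: "y \<in> set ys'" for y
      proof -
        obtain j where j: "j < length ys'" "y = ys' ! j"
          using y by (auto simp: in_set_conv_nth)
        show ?thesis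
        proof (cases "j = i")
          case True
          have "ys' ! i + a *s z - a *s z \<in> fibre_span Q (set zs)"
            using zs_i subset_fibre_span[OF prime_Q, of "set zs"]
              scale_in_fibre_span[OF prime_Q a(2)[OF Q], of z]
            by (intro subspace_diff[OF subspace_fibre_span[OF prime_Q]]) auto
          then show ?thesis
            using j True by simp
        next
          case False
          then have "y = zs ! j" "j < length zs"
            using j by (simp_all add: zs_def)
          then show ?thesis
            using subset_fibre_span[OF prime_Q, of "set zs"] by auto
        qed
      qed
      then show ?thesis
        using fibre_span_subset[OF prime_Q, of "set ys'" "set zs"] ys'(2)[OF Q] by blast
    qed
    ultimately show ?thesis
      by blast
  qed (use ys' in blast)
qed

text \<open>Semicontinuity: the primes where \<open>M/N\<close> needs at least \<open>t\<close>
  generators form a closed set. Where fewer suffice, \<open>uniform_denominator\<close> gives a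
  common denominator outside \<open>P\<close>, which belongs to the ideal.\<close>

lemma mu_loc_ge_iff:
  assumes fg: "finitely_generated_module scale" and P: "prime_ideal P"
  shows "t \<le> mu_loc scale P N \<longleftrightarrow>
    ideal_gen {s. \<exists>S. finite S \<and> card S < t \<and> (\<forall>m. s *s m \<in> span (S \<union> N))} \<subseteq> P"
    (is "_ \<longleftrightarrow> ideal_gen ?D \<subseteq> P")
proof
  assume t: "t \<le> mu_loc scale P N"
  have "?D \<subseteq> P"
  proof
    fix s
    assume "s \<in> ?D"
    then obtain S where S: "finite S" "card S < t" "\<forall>m. s *s m \<in> span (S \<union> N)"
      by blast
    show "s \<in> P"
    proof (rule ccontr)
      assume "s \<notin> P"
      then have "mu_loc scale P N \<le> card S"
        using S by (intro mu_loc_le) blast+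
      then show False
        using t S(2) by simp
    qed
  qed
  then show "ideal_gen ?D \<subseteq> P"
    by (rule ideal_gen_least[OF prime_ideal_ideal[OF P]])
next
  assume D: "ideal_gen ?D \<subseteq> P"
  show "t \<le> mu_loc scale P N"
  proof (rule ccontr)
    assume "\<not> ?thesis"
    moreover obtain S where S: "finite S" "card S = mu_loc scale P N"
      "\<And>m. \<exists>s. s \<notin> P \<and> s *s m \<in> span (S \<union> N)"
      by (rule mu_loc_witness[OF fg P]) blast
    moreover obtain G where G: "finite G" "span G = UNIV"
      using fg by (auto simp: finitely_generated_module_def)
    moreover obtain s where "s \<notin> P" "\<forall>m\<in>span G. s *s m \<in> span (S \<union> N)"
      using uniform_denominator[OF P subspace_span G(1), of "S \<union> N"] S(3) by blast
    ultimately have "s \<in> ?D"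
      by auto
    then show False
      using D \<open>s \<notin> P\<close> ideal_gen_superset[of ?D] by blast
  qed
qed

section \<open>Existence of basic elements\<close>

text \<open>A critical prime has minimal depth on the closed set belonging to its own value of
  \<open>mu_loc\<close>, and these values are bounded by the number of global generators. So
  \<open>finite_min_depth_primes\<close> is applied finitely often.\<close>

lemma finite_critical_primes:
  assumes noeth: "noetherian_ring TYPE('a)" and fg: "finitely_generated_module scale"
    and hyp: "\<And>P Q. P \<in> C_set n \<Longrightarrow> Q \<in> C_set n \<Longrightarrow> depth_loc Q < depth_loc P \<Longrightarrow>
      mu_loc scale Q {} \<le> mu_loc scale P {}"
    and N: "\<And>P. P \<in> C_set n \<Longrightarrow>
      mu_loc scale P N + min k (n + 1 - depth_loc P) \<le> mu_loc scale P {}"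
  shows "finite {P \<in> C_set n. n + 1 - depth_loc P < k \<and>
    mu_loc scale P N + (n + 1 - depth_loc P) = mu_loc scale P {}}" (is "finite ?E")
proof -
  define I where "I t = ideal_gen {s. \<exists>S. finite S \<and> card S < t \<and> (\<forall>m. s *s m \<in> span (S \<union> N))}" for t
  have I: "I t \<subseteq> P \<longleftrightarrow> t \<le> mu_loc scale P N" if "P \<in> C_set n" for P t
    using mu_loc_ge_iff[OF fg] that by (simp add: C_set_def I_def)
  let ?M = "\<lambda>t. {P \<in> C_set n. I t \<subseteq> P \<and> (\<forall>Q\<in>C_set n. I t \<subseteq> Q \<longrightarrow> depth_loc P \<le> depth_loc Q)}"
  obtain G where G: "finite G" "span G = UNIV"
    using fg by (auto simp: finitely_generated_module_def)
  have "P \<in> (\<Union>t\<le>card G. ?M t)" if P: "P \<in> ?E" for P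
  proof -
    let ?t = "mu_loc scale P N"
    have prime_P: "prime_ideal P"
      using P by (simp add: C_set_def)
    have "1 *s m \<in> span (G \<union> N)" for m
      using G(2) span_mono[of G "G \<union> N"] by auto
    then have "?t \<le> card G"
      using prime_ideal_one[OF prime_P] by (intro mu_loc_le[OF G(1)]) blast
    \<comment> \<open>At a \<open>Q\<close> of smaller depth, \<open>N\<close> would have to lower
      the number of generators by more than \<open>n + 1 - depth_loc P\<close>, as this is below
      \<open>k\<close>. But \<open>Q\<close> starts from at most the number at \<open>P\<close> and
      keeps at least as many modulo \<open>N\<close>.\<close>
    moreover have "depth_loc P \<le> depth_loc Q" if Q: "Q \<in> C_set n" "?t \<le> mu_loc scale Q N" for Q
    proof (rule ccontr)
      assume lt: "\<not> ?thesis"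
      then have "mu_loc scale Q {} \<le> mu_loc scale P {}"
        using hyp[of P Q] P Q(1) by simp
      moreover have "depth_loc P \<le> n"
        using P by (simp add: C_set_def)
      ultimately show False
        using N[OF Q(1)] P Q(2) lt by (auto simp: min_def split: if_splits)
    qed
    ultimately show ?thesis
      using P I by auto
  qed
  then have "?E \<subseteq> (\<Union>t\<le>card G. ?M t)"
    by blast
  moreover have "finite (\<Union>t\<le>card G. ?M t)"
    using finite_min_depth_primes[OF noeth] is_ideal_ideal_gen unfolding I_def by blast
  ultimately show ?thesis
    by (rule finite_subset)
qed

text \<open>Each induction step shifts the other generators by multiples of the last one,
  \<open>z\<close>, and then drops \<open>z\<close>. The bound is additive to avoid truncated
  subtraction of generator numbers.\<close>

lemma ex_basic:
  assumes noeth: "noetherian_ring TYPE('a)" and fg: "finitely_generated_module scale"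
    and hyp: "\<And>P Q. P \<in> C_set n \<Longrightarrow> Q \<in> C_set n \<Longrightarrow> depth_loc Q < depth_loc P \<Longrightarrow>
      mu_loc scale Q {} \<le> mu_loc scale P {}"
  shows "length xs = Suc k \<Longrightarrow> (\<And>P. P \<in> C_set n \<Longrightarrow>
      mu_loc scale P (span (set xs)) + min (Suc k) (n + 1 - depth_loc P) \<le> mu_loc scale P {}) \<Longrightarrow>
    \<exists>x'\<in>span (set (tl xs)). \<forall>P\<in>C_set n. mu_loc scale P (span {hd xs + x'}) + 1 \<le> mu_loc scale P {}"
proof (induction k arbitrary: xs)
  case 0
  then obtain x where xs: "xs = [x]"
    by (auto simp: length_Suc_conv)
  have "mu_loc scale P (span {x}) + 1 \<le> mu_loc scale P {}" if "P \<in> C_set n" for P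
  proof -
    \<comment> \<open>On \<open>C_set n\<close> the depth is at most \<open>n\<close>, so
      \<open>n + 1 - depth_loc P\<close> is at least 1.\<close>
    have "min (Suc 0) (n + 1 - depth_loc P) = 1"
      using that by (auto simp: C_set_def)
    then show ?thesis
      using "0.prems"(2)[OF that] by (simp add: xs)
  qed
  then show ?case
    by (simp add: xs)
next
  case (Suc k)
  obtain ys z where xs: "xs = ys @ [z]" and len: "length ys = Suc k"
    using Suc.prems(1) by (cases xs rule: rev_cases) auto
  have set_xs: "set xs = insert z (set ys)"
    by (simp add: xs)
  let ?N = "span (insert z (set ys))"
  let ?E = "{P \<in> C_set n. n + 1 - depth_loc P < Suc (Suc k) \<and>
    mu_loc scale P ?N + (n + 1 - depth_loc P) = mu_loc scale P {}}"
  note N = Suc.prems(2)[unfolded set_xs]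
  have "finite ?E"
    by (rule finite_critical_primes[OF noeth fg hyp N])
  \<comment> \<open>On \<open>?E\<close> the number of generators drops by exactly
    \<open>n + 1 - depth_loc P\<close>, which is less than \<open>length ys + 1\<close>; this is the
    dependence needed in the fibre.\<close>
  then have "\<exists>ys'. shifted z ys ys' \<and> (\<forall>P\<in>?E. z \<in> fibre_span P (set ys'))"
    by (intro ex_shifted_same_fibre_span[OF fg]) (auto simp: C_set_def len)
  then obtain ys' where ys': "shifted z ys ys'" and E: "\<And>P. P \<in> ?E \<Longrightarrow> z \<in> fibre_span P (set ys')"
    by blast
  have N_sub: "?N \<subseteq> span (insert z (set ys'))"
    using shifted_span(2)[OF ys'] by (intro span_minimal) (auto simp: span_base)
  have "\<exists>x'\<in>span (set (tl ys')). \<forall>P\<in>C_set n. mu_loc scale P (span {hd ys' + x'}) + 1 \<le> mu_loc scale P {}"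
  proof (rule Suc.IH)
    show "length ys' = Suc k"
      using list_all2_lengthD[OF ys'] len by simp
    fix P :: "'a set"
    assume P: "P \<in> C_set n"
    then have prime_P: "prime_ideal P"
      by (simp add: C_set_def)
    let ?mu = "mu_loc scale P (span (set ys'))"
    have "?N \<subseteq> span (insert z (span (set ys')))"
      using N_sub span_mono[of "insert z (set ys')" "insert z (span (set ys'))"] span_superset[of "set ys'"]
      by blast
    then have le: "?mu \<le> mu_loc scale P ?N + 1"
      by (rule mu_loc_insert[OF fg prime_P])
    show "?mu + min (Suc k) (n + 1 - depth_loc P) \<le> mu_loc scale P {}"
    proof (cases "P \<in> ?E")
      case True
      have "insert z (set ys') \<subseteq> fibre_span P (span (set ys'))"
        using E[OF True] fibre_span_mono[of "set ys'" "span (set ys')" P] span_superset[of "set ys'"]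
          subset_fibre_span[OF prime_P, of "set ys'"] by blast
      then have "?N \<subseteq> fibre_span P (span (set ys'))"
        using N_sub span_minimal[OF _ subspace_fibre_span[OF prime_P]] by blast
      then have "?mu \<le> mu_loc scale P ?N"
        by (rule mu_loc_antimono[OF fg prime_P])
      then show ?thesis
        using N[OF P] by simp
    next
      \<comment> \<open>Losing \<open>z\<close> costs at most one generator. Either the required
        minimum also falls by one, or the inequality for \<open>?N\<close> was strict.\<close>
      case False
      then show ?thesis
        using N[OF P] P le by (auto simp: min_def split: if_splits)
    qed
  qed
  then obtain x' where x': "x' \<in> span (set (tl ys'))"
    "\<forall>P\<in>C_set n. mu_loc scale P (span {hd ys' + x'}) + 1 \<le> mu_loc scale P {}" ..
  obtain y ws where ys: "ys = y # ws"
    using len by (cases ys) auto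
  \<comment> \<open>The shift of the head is moved into \<open>x'\<close>: \<open>z\<close> is the
    last entry of \<open>xs\<close>, hence an element of its tail.\<close>
  obtain a ws' where ys'_eq: "ys' = (y + a *s z) # ws'" and ws': "shifted z ws ws'"
    using ys' by (auto simp: ys list_all2_Cons1)
  have "span (set ws') \<subseteq> span (insert z (set ws))"
    using shifted_span(1)[OF ws'] by (rule span_minimal) simp
  then have "x' \<in> span (insert z (set ws))"
    using x'(1) by (auto simp: ys'_eq)
  then have "a *s z + x' \<in> span (insert z (set ws))"
    by (intro span_add span_scale) (auto intro: span_base)
  then have "a *s z + x' \<in> span (set (tl xs))"
    by (simp add: xs ys)
  moreover have "hd xs + (a *s z + x') = hd ys' + x'"
    by (simp add: xs ys ys'_eq add.assoc)
  ultimately show ?case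
    using x'(2) by metis
qed

end

theorem theorem1:
  fixes scale :: "'a::comm_ring_1 \<Rightarrow> 'm::ab_group_add \<Rightarrow> 'm"
    and n :: nat
  assumes noeth: "noetherian_ring TYPE('a)"
    and modl: "module scale"
    and fg: "finitely_generated_module scale"
    and hyp: "\<forall>P \<in> C_set n. \<forall>Q \<in> C_set n.
                depth_loc P > depth_loc Q \<longrightarrow> mu_loc scale P {} \<ge> mu_loc scale Q {}"
  shows "((\<forall>P \<in> C_set n. mu_loc scale P {} > n) \<longrightarrow>
            (\<exists>x. \<forall>P \<in> C_set n. basic scale P x))
       \<and> (\<forall>xs :: 'm list. length xs \<ge> 1 \<longrightarrow>
            (\<forall>P \<in> C_set n. s_basic scale (min (int (length xs)) (int n + 1 - int (depth_loc P)))
                                   P (module.span scale (set xs))) \<longrightarrow>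
            (\<exists>x' \<in> module.span scale (set (tl xs)). \<forall>P \<in> C_set n. basic scale P (hd xs + x')))"
proof -
  interpret module scale
    by (rule modl)
  have basic: "basic scale P x \<longleftrightarrow> mu_loc scale P (span {x}) + 1 \<le> mu_loc scale P {}" for P x
    by (auto simp: basic_def s_basic_def)
  have main: "\<exists>x'\<in>span (set (tl xs)). \<forall>P\<in>C_set n. basic scale P (hd xs + x')"
    if "length xs = Suc k" "\<And>P. P \<in> C_set n \<Longrightarrow>
      mu_loc scale P (span (set xs)) + min (Suc k) (n + 1 - depth_loc P) \<le> mu_loc scale P {}" for xs k
    unfolding basic by (rule ex_basic[OF noeth fg _ that]) (use hyp in blast)+
  show ?thesis
  proof (intro conjI allI impI)
    assume mu: "\<forall>P\<in>C_set n. mu_loc scale P {} > n"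
    obtain G where "finite G" "span G = UNIV"
      using fg by (auto simp: finitely_generated_module_def)
    then obtain gs where gs: "span (set gs) = UNIV"
      using finite_list by blast
    \<comment> \<open>The leading \<open>0\<close> makes the list nonempty and contributes nothing
      as head. The quotient by the full span needs no generators, so the bound follows from
      \<open>n < mu_loc scale P {}\<close>.\<close>
    have span_UN: "span (set (0 # gs)) = UNIV"
      using gs span_mono[of "set gs" "set (0 # gs)"] by auto
    have "mu_loc scale P (span (set (0 # gs))) + min (Suc (length gs)) (n + 1 - depth_loc P)
      \<le> mu_loc scale P {}" if "P \<in> C_set n" for P
    proof -
      have "prime_ideal P"
        using that by (simp add: C_set_def)
      then have "mu_loc scale P (span (set (0 # gs))) \<le> card ({} :: 'm set)"
        using prime_ideal_one unfolding span_UN by (intro mu_loc_le) auto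
      then show ?thesis
        using mu that by fastforce
    qed
    then show "\<exists>x. \<forall>P\<in>C_set n. basic scale P x"
      using main[of "0 # gs" "length gs"] by auto
  next
    fix xs :: "'m list"
    assume len: "length xs \<ge> 1"
      and xs: "\<forall>P\<in>C_set n. s_basic scale (min (int (length xs)) (int n + 1 - int (depth_loc P))) P (span (set xs))"
    obtain k where k: "length xs = Suc k"
      using len by (cases "length xs") auto
    have "mu_loc scale P (span (set xs)) + min (Suc k) (n + 1 - depth_loc P) \<le> mu_loc scale P {}"
      if P: "P \<in> C_set n" for P
    proof -
      have "depth_loc P \<le> n"
        using P by (simp add: C_set_def)
      then show ?thesis
        using xs P unfolding s_basic_def k by (auto simp: min_def split: if_splits)
    qed
    then show "\<exists>x'\<in>span (set (tl xs)). \<forall>P\<in>C_set n. basic scale P (hd xs + x')"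
      by (rule main[OF k])
  qed
qed

end
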